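(* There is a universal constant $K$ such that the following holds. Let $n\ge m\ge 1$ be integers, let $Y\in\mathbb{R}^{n\times m}$ be any matrix, let $s\ge 1$ be an integer (the sample size), let $r>0$, let $p$ be any probability distribution on $[n]\times[m]$, and let $\ell$ be an $l$-Lipschitz loss. Let $\tilde p$ denote the smoothed marginals of $p$. Given a sample $S=((i_1,j_1),\dots,(i_s,j_s))$ drawn i.i.d. from $p$, let $\hat X_S\in\arg\min\{\hat L_S(X): X\in\mathcal{W}_r[\tilde p]\}$. Then $$\mathbf{E}_S\big[L_p(\hat X_S)\big]\le \inf_{X\in\mathcal{W}_r[\tilde p]}L_p(X)+K\, l\,\sqrt{\frac{rn\log(n)}{s}}.$$
   Context: For a probability distribution $p$ on $[n]\times[m]$, $p^r(i)=\sum_j p(i,j)$ and $p^c(j)=\sum_i p(i,j)$ are its row and column marginals. The smoothed marginals (smoothing parameter $\alpha=\frac12$) are $\tilde p^r(i)=\frac12\left(p^r(i)+\frac1n\right)$ and $\tilde p^c(j)=\frac12\left(p^c(j)+\frac1m\right)$. $\|\cdot\|_{\mathrm{tr}}$ is the trace-norm (sum of singular values). For nonnegative weight vectors $q^r\in\mathbb{R}^n$, $q^c\in\mathbb{R}^m$, the weighted trace-norm of $X\in\mathbb{R}^{n\times m}$ is $\|X\|_{\mathrm{tr}(q^r,q^c)}=\|\mathrm{diag}(q^r)^{1/2}\,X\,\mathrm{diag}(q^c)^{1/2}\|_{\mathrm{tr}}$, and $\mathcal{W}_r[q]=\{X\in\mathbb{R}^{n\times m}:\|X\|_{\mathrm{tr}(q^r,q^c)}\le\sqrt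 r\}$ (in $\mathcal{W}_r$, the subscript $r$ is the number $r>0$; in $q^r,p^r$ the superscript $r$ stands for "row"). A loss is a function $\ell:\mathbb{R}\times\mathbb{R}\to\mathbb{R}$; it is $l$-Lipschitz if $|\ell(x,y)-\ell(x',y)|\le l|x-x'|$ for all $x,x',y$. The expected loss is $L_p(X)=\sum_{i,j}p(i,j)\,\ell(X_{ij},Y_{ij})$ and the empirical loss is $\hat L_S(X)=\frac1s\sum_{t=1}^s\ell(X_{i_tj_t},Y_{i_tj_t})$. $\hat X_S$ is any choice of minimizer. *)

theory Defs
  imports
    "HOL-Probability.Probability"
    "Jordan_Normal_Form.Char_Poly"
begin

(* Entry positions are 0-based: [n] x [m] is {..<n} \<times> {..<m}, as for carrier_mat n m. *)

(* The real matrix A^T A is positive semidefinite, so its characteristic polynomial splits over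
   the reals with nonnegative roots; proots counts them with multiplicity.  For an n x m matrix
   this lists m values, hence for n < m it contains m - n extra zeros, which do not affect the
   trace-norm. *)
definition singular_values :: "real mat \<Rightarrow> real multiset" where
  "singular_values A = image_mset sqrt (proots (char_poly (transpose_mat A * A)))"

definition trace_norm :: "real mat \<Rightarrow> real" where
  "trace_norm A = sum_mset (singular_values A)"

definition weighted_trace_norm :: "(nat \<Rightarrow> real) \<Rightarrow> (nat \<Rightarrow> real) \<Rightarrow> real mat \<Rightarrow> real" where
  "weighted_trace_norm qr qc X =
     trace_norm (mat_diag (dim_row X) (\<lambda>i. sqrt (qr i)) * X * mat_diag (dim_col X) (\<lambda>j. sqrt (qc j)))"

definition weighted_class ::
    "nat \<Rightarrow> nat \<Rightarrow> real \<Rightarrow> (nat \<Rightarrow> real) \<Rightarrow> (nat \<Rightarrow> real) \<Rightarrow> real mat set" where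
  "weighted_class n m r qr qc =
     {X \<in> carrier_mat n m. weighted_trace_norm qr qc X \<le> sqrt r}"

definition row_marginal :: "nat \<Rightarrow> (nat \<times> nat) pmf \<Rightarrow> nat \<Rightarrow> real" where
  "row_marginal m p i = (\<Sum>j<m. pmf p (i, j))"

definition col_marginal :: "nat \<Rightarrow> (nat \<times> nat) pmf \<Rightarrow> nat \<Rightarrow> real" where
  "col_marginal n p j = (\<Sum>i<n. pmf p (i, j))"

definition smoothed_row :: "nat \<Rightarrow> nat \<Rightarrow> (nat \<times> nat) pmf \<Rightarrow> nat \<Rightarrow> real" where
  "smoothed_row n m p i = 1 / 2 * (row_marginal m p i + 1 / real n)"

definition smoothed_col :: "nat \<Rightarrow> nat \<Rightarrow> (nat \<times> nat) pmf \<Rightarrow> nat \<Rightarrow> real" where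
  "smoothed_col n m p j = 1 / 2 * (col_marginal n p j + 1 / real m)"

definition smoothed_class :: "nat \<Rightarrow> nat \<Rightarrow> real \<Rightarrow> (nat \<times> nat) pmf \<Rightarrow> real mat set" where
  "smoothed_class n m r p = weighted_class n m r (smoothed_row n m p) (smoothed_col n m p)"

definition lipschitz_loss :: "real \<Rightarrow> (real \<Rightarrow> real \<Rightarrow> real) \<Rightarrow> bool" where
  "lipschitz_loss l ell \<longleftrightarrow> (\<forall>x x' y. \<bar>ell x y - ell x' y\<bar> \<le> l * \<bar>x - x'\<bar>)"

definition expected_loss ::
    "nat \<Rightarrow> nat \<Rightarrow> (real \<Rightarrow> real \<Rightarrow> real) \<Rightarrow> real mat \<Rightarrow> (nat \<times> nat) pmf \<Rightarrow> real mat \<Rightarrow> real" where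
  "expected_loss n m ell Y p X =
     (\<Sum>i<n. \<Sum>j<m. pmf p (i, j) * ell (X $$ (i, j)) (Y $$ (i, j)))"

definition empirical_loss ::
    "(real \<Rightarrow> real \<Rightarrow> real) \<Rightarrow> real mat \<Rightarrow> (nat \<times> nat) list \<Rightarrow> real mat \<Rightarrow> real" where
  "empirical_loss ell Y S X =
     1 / real (length S) * (\<Sum>t<length S. ell (X $$ (S ! t)) (Y $$ (S ! t)))"

end

theory Submission
  imports Defs
begin

text \<open>For \<open>n = 1\<close> both losses coincide. If \<open>s < n ln n\<close>, the bound is at least of order \<open>l \<surd>r\<close>, and the mean
  of \<open>\<bar>X\<bar>\<close> under $p$ is at most \<open>2 \<surd>r\<close> on the class, so nothing has to be learned. Otherwise symmetrization and
  contraction reduce the excess loss to the Rademacher average of the class, which by trace-norm duality is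
  the expected spectral norm of a random signed sum \<open>S\<close> of sparse matrices. For a fixed sample the trace moments
  of \<open>S\<close> satisfy a recursion (a noncommutative Khintchine inequality): conditioning on all signs but one turns
  $\sigma_t \,\mathrm{tr}(H_t S^{2k-1})$ into the difference of two traces of powers, which is evaluated in the
  eigenbases of the two matrices. It bounds the spectral norm by the maximal row and column variance,
  whose expectation is controlled by an exponential moment.\<close>

section \<open>Orthonormal eigenbases of real symmetric matrices\<close>

text \<open>The obstacle is a draw of a rare cell: its weight \<open>1 / (q^r q^c)\<close> is not
  controlled by the marginals of $p$ alone. The uniform part of the smoothing caps it at
  \<open>4 * n * m\<close>, while the part coming from $p$ keeps its mean in any row or column at
  most \<open>4 * n\<close>. Over \<open>s\<close> draws the maximal variance then has mean of order
  \<open>n s + n m ln n\<close>, and since \<open>m \<le> n\<close> the second term is absorbed once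
  \<open>s \<ge> n ln n\<close>; this dictates the case split. Finite families suffice for
  symmetrization and contraction: there are finitely many samples from the support, hence finitely
  many values of the minimizer, and no supremum over the whole class or measurability question
  arises. Contraction precedes duality because duality needs an expression linear in
  \<open>X\<close>. Moments of order about \<open>ln (n + m)\<close> lose only a constant to the
  dimension; their growth with the order is the source of the logarithm in the rate. The constant
  \<open>136\<close> is \<open>2 * 2 * 34\<close>: symmetrization, the spectral-norm bound, and
  \<open>34^2 = 1156\<close> for the remaining factors.\<close>

lemma real_eigenvector:
  fixes A :: "real mat"
  assumes A: "A \<in> carrier_mat n n" and sym: "transpose_mat A = A" and n: "n \<noteq> 0"
  obtains lam v where "v \<in> carrier_vec n" "v \<noteq> 0\<^sub>v n" "A *\<^sub>v v = lam \<cdot>\<^sub>v v"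
proof -
  let ?C = "map_mat complex_of_real A"
  have C: "?C \<in> carrier_mat n n" using A by simp
  obtain as where as: "char_poly ?C = (\<Prod>a\<leftarrow>as. [:- a, 1:])" "length as = n"
    using char_poly_factorized[OF C] by blast
  define z where "z = hd as"
  have "z \<in> set as" using as n unfolding z_def by (cases as) auto
  hence "poly (char_poly ?C) z = 0"
    unfolding as by (induction as) auto
  hence "eigenvalue ?C z" using eigenvalue_root_char_poly[OF C] by simp
  then obtain x where x: "x \<in> carrier_vec n" "x \<noteq> 0\<^sub>v n" "?C *\<^sub>v x = z \<cdot>\<^sub>v x"
    using C unfolding eigenvalue_def eigenvector_def by auto
  have A_sym: "A $$ (i, j) = A $$ (j, i)" if "i < n" "j < n" for i j
    using arg_cong[OF sym, of "\<lambda>M. M $$ (j, i)"] A that by simp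
  have eq: "(\<Sum>j<n. of_real (A $$ (i, j)) * x $ j) = z * x $ i" if "i < n" for i
    using arg_cong[OF x(3), of "\<lambda>v. v $ i"] that A x(1)
    by (simp add: scalar_prod_def lessThan_atLeast0)
  define a where "a i = Re (x $ i)" for i
  define b where "b i = Im (x $ i)" for i
  have ea: "(\<Sum>j<n. A $$ (i, j) * a j) = Re z * a i - Im z * b i" if "i < n" for i
    using arg_cong[OF eq[OF that], of Re] by (simp add: a_def b_def Re_sum)
  have eb: "(\<Sum>j<n. A $$ (i, j) * b j) = Re z * b i + Im z * a i" if "i < n" for i
    using arg_cong[OF eq[OF that], of Im] by (simp add: a_def b_def Im_sum)
  \<comment> \<open>Symmetry pairs the real and imaginary parts of the eigenvector; inserting
    \<open>ea\<close> and \<open>eb\<close> leaves \<open>Im z * (|a|^2 + |b|^2) = 0\<close>, so the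
    eigenvalue is real.\<close>
  have "(\<Sum>i<n. b i * (\<Sum>j<n. A $$ (i, j) * a j)) = (\<Sum>i<n. a i * (\<Sum>j<n. A $$ (i, j) * b j))"
  proof -
    have "(\<Sum>i<n. b i * (\<Sum>j<n. A $$ (i, j) * a j)) = (\<Sum>j<n. \<Sum>i<n. b i * (A $$ (i, j) * a j))"
      unfolding sum_distrib_left by (rule sum.swap)
    also have "\<dots> = (\<Sum>i<n. a i * (\<Sum>j<n. A $$ (i, j) * b j))"
      unfolding sum_distrib_left by (intro sum.cong refl) (use A_sym in auto)
    finally show ?thesis .
  qed
  hence "(\<Sum>i<n. b i * (Re z * a i - Im z * b i)) = (\<Sum>i<n. a i * (Re z * b i + Im z * a i))"
    using ea eb by simp
  hence "0 = (\<Sum>i<n. Im z * ((a i)\<^sup>2 + (b i)\<^sup>2))"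
    by (simp add: algebra_simps sum_subtractf sum.distrib power2_eq_square sum_negf)
  hence "Im z * (\<Sum>i<n. (a i)\<^sup>2 + (b i)\<^sup>2) = 0"
    by (simp add: sum_distrib_left)
  moreover have "(\<Sum>i<n. (a i)\<^sup>2 + (b i)\<^sup>2) \<noteq> 0"
  proof
    assume "(\<Sum>i<n. (a i)\<^sup>2 + (b i)\<^sup>2) = 0"
    hence "\<forall>i<n. (a i)\<^sup>2 + (b i)\<^sup>2 = 0"
      by (subst (asm) sum_nonneg_eq_0_iff) auto
    hence "\<forall>i<n. x $ i = 0" by (auto simp: a_def b_def complex_eq_iff sum_power2_eq_zero_iff)
    hence "x = 0\<^sub>v n" using x(1) by (intro eq_vecI) auto
    thus False using x(2) by simp
  qed
  ultimately have "Im z = 0" by simp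
  have ev: "A *\<^sub>v vec n f = Re z \<cdot>\<^sub>v vec n f" if "\<And>i. i < n \<Longrightarrow> (\<Sum>j<n. A $$ (i, j) * f j) = Re z * f i" for f
    using A that by (intro eq_vecI) (auto simp: scalar_prod_def lessThan_atLeast0)
  show ?thesis
  proof (cases "vec n a = 0\<^sub>v n")
    case False
    thus ?thesis using that[of "vec n a" "Re z"] ev[of a] ea \<open>Im z = 0\<close> by simp
  next
    case True
    have "vec n b \<noteq> 0\<^sub>v n"
    proof
      assume b0: "vec n b = 0\<^sub>v n"
      have "a i = 0 \<and> b i = 0" if "i < n" for i
        using arg_cong[OF True, of "\<lambda>v. v $ i"] arg_cong[OF b0, of "\<lambda>v. v $ i"] that by simp
      hence "x = 0\<^sub>v n" using x(1) by (intro eq_vecI) (auto simp: a_def b_def complex_eq_iff)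
      thus False using x(2) by simp
    qed
    thus ?thesis using that[of "vec n b" "Re z"] ev[of b] eb \<open>Im z = 0\<close> by simp
  qed
qed

text \<open>A Householder reflection.\<close>

lemma orthogonal_matrix_with_first_column:
  fixes v :: "nat \<Rightarrow> real"
  assumes n: "0 < n" and v: "(\<Sum>i<n. (v i)\<^sup>2) = 1"
  obtains R where "R \<in> carrier_mat n n" "transpose_mat R = R" "R * R = 1\<^sub>m n"
    "\<And>i. i < n \<Longrightarrow> R $$ (i, 0) = v i"
proof -
  define w where "w i = (if i = 0 then 1 else 0) - v i" for i
  \<comment> \<open>For \<open>v = e_0\<close> the vector \<open>w\<close> vanishes and
    \<open>c = 2 / 0 = 0\<close>, so \<open>R\<close> is the identity and the degenerate case needs
    no separate definition.\<close>
  define c where "c = 2 / (\<Sum>i<n. (w i)\<^sup>2)"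
  define R where "R = mat n n (\<lambda>(i, j). (if i = j then 1 else 0) - c * w i * w j)"
  \<comment> \<open>As \<open>|v| = 1\<close>, \<open>|e_0 - v|^2 = 2 - 2 * v_0\<close>. Hence
    \<open>c * w_0 = 1\<close> unless \<open>w = 0\<close>, and the first column of \<open>R\<close>
    is \<open>e_0 - w = v\<close>.\<close>
  have ww: "(\<Sum>i<n. (w i)\<^sup>2) = 2 * w 0"
  proof -
    have "(\<Sum>i<n. (w i)\<^sup>2) = (\<Sum>i<n. (if i = 0 then 1 - 2 * v 0 else 0) + (v i)\<^sup>2)"
      by (intro sum.cong) (auto simp: w_def power2_eq_square algebra_simps)
    also have "\<dots> = 2 * w 0" using n v by (simp add: sum.distrib w_def)
    finally show ?thesis .
  qed
  have w0: "w i = 0" if "w 0 = 0" "i < n" for i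
  proof -
    have "(\<Sum>i<n. (w i)\<^sup>2) = 0" using ww that by simp
    thus ?thesis using that by (subst (asm) sum_nonneg_eq_0_iff) auto
  qed
  have cw: "c * (\<Sum>i<n. (w i)\<^sup>2) * w i = 2 * w i" if "i < n" for i
    using w0[OF _ that] ww by (cases "w 0 = 0") (auto simp: c_def)
  have cw0: "c * w i * w 0 = w i" if "i < n" for i
    using cw[OF that] unfolding ww by (simp add: algebra_simps)
  have "R $$ (i, 0) = v i" if "i < n" for i
  proof -
    have "R $$ (i, 0) = (if i = 0 then 1 else 0) - c * w i * w 0"
      using that n by (simp add: R_def)
    also have "\<dots> = v i" unfolding cw0[OF that] by (simp add: w_def)
    finally show ?thesis .
  qed
  moreover have "R * R = 1\<^sub>m n"
  proof (rule eq_matI)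
    fix i j assume ij: "i < dim_row (1\<^sub>m n :: real mat)" "j < dim_col (1\<^sub>m n :: real mat)"
    have "(R * R) $$ (i, j) = (\<Sum>k<n. ((if i = k then 1 else 0) - c * w i * w k) * ((if k = j then 1 else 0) - c * w k * w j))"
      using ij by (simp add: R_def scalar_prod_def lessThan_atLeast0)
    also have "\<dots> = (\<Sum>k<n. (if k = i then (if i = j then 1 else 0) - c * w i * w j else 0)
        - (if k = j then c * w i * w j else 0) + c * (c * (w k)\<^sup>2 * w i) * w j)"
      by (intro sum.cong) (auto simp: algebra_simps power2_eq_square)
    also have "\<dots> = (if i = j then 1 else 0) - 2 * (c * w i * w j) + c * (c * (\<Sum>i<n. (w i)\<^sup>2) * w i) * w j"
      using ij by (simp add: sum.distrib sum_subtractf sum_distrib_left sum_distrib_right)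
    also have "\<dots> = (if i = j then 1 else 0)" using ij by (subst cw) auto
    finally show "(R * R) $$ (i, j) = 1\<^sub>m n $$ (i, j)" using ij by simp
  qed (auto simp: R_def)
  moreover have "R \<in> carrier_mat n n" "transpose_mat R = R"
    by (auto simp: R_def intro!: eq_matI)
  ultimately show ?thesis using that by blast
qed

text \<open>Deflation: a reflection \<open>R\<close> with a unit eigenvector as first column turns
  \<open>A\<close> into \<open>R A R\<close>, whose first row and column vanish off the diagonal;
  the induction hypothesis diagonalizes the remaining block.\<close>

lemma symmetric_diagonalization:
  fixes A :: "real mat"
  assumes "A \<in> carrier_mat n n" "transpose_mat A = A"
  shows "\<exists>P D. P \<in> carrier_mat n n \<and> D \<in> carrier_mat n n \<and> transpose_mat P * P = 1\<^sub>m n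
    \<and> diagonal_mat D \<and> A * P = P * D"
  using assms
proof (induction n arbitrary: A)
  case 0
  show ?case
    by (rule exI[of _ "1\<^sub>m 0"], rule exI[of _ "1\<^sub>m 0"]) (use 0 in \<open>auto simp: diagonal_mat_def\<close>)
next
  case (Suc n)
  let ?N = "Suc n"
  note A = Suc.prems(1)
  obtain lam v where v: "v \<in> carrier_vec ?N" "v \<noteq> 0\<^sub>v ?N" "A *\<^sub>v v = lam \<cdot>\<^sub>v v"
    by (rule real_eigenvector[OF Suc.prems]) auto
  define c where "c = sqrt (\<Sum>i<?N. (v $ i)\<^sup>2)"
  have "(\<Sum>i<?N. (v $ i)\<^sup>2) \<noteq> 0"
  proof
    assume "(\<Sum>i<?N. (v $ i)\<^sup>2) = 0"
    hence "\<forall>i<?N. v $ i = 0" by (subst (asm) sum_nonneg_eq_0_iff) auto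
    hence "v = 0\<^sub>v ?N" using v(1) by (intro eq_vecI) auto
    thus False using v(2) by simp
  qed
  hence c: "c \<noteq> 0" "c\<^sup>2 = (\<Sum>i<?N. (v $ i)\<^sup>2)" by (auto simp: c_def sum_nonneg)
  have "(\<Sum>i<?N. (v $ i / c)\<^sup>2) = 1"
    unfolding power_divide sum_divide_distrib[symmetric] c(2)[symmetric] using c(1) by simp
  then obtain R where R: "R \<in> carrier_mat ?N ?N" "transpose_mat R = R" "R * R = 1\<^sub>m ?N"
    "\<And>i. i < ?N \<Longrightarrow> R $$ (i, 0) = v $ i / c"
    using orthogonal_matrix_with_first_column[of ?N "\<lambda>i. v $ i / c"] by auto
  define B where "B = R * (A * R)"
  have B: "B \<in> carrier_mat ?N ?N" using A R by (simp add: B_def)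
  have B_sym: "transpose_mat B = B"
    unfolding B_def using A R Suc.prems(2)
    by (simp add: transpose_mult[of _ ?N ?N _ ?N] assoc_mult_mat[of _ ?N ?N _ ?N _ ?N])
  have AR0: "(A * R) $$ (i, 0) = lam * R $$ (i, 0)" if "i < ?N" for i
  proof -
    have "(A * R) $$ (i, 0) = (\<Sum>j<?N. A $$ (i, j) * (v $ j / c))"
      using that A R by (simp add: scalar_prod_def lessThan_atLeast0 del: sum.lessThan_Suc sum.op_ivl_Suc)
    also have "\<dots> = (\<Sum>j<?N. A $$ (i, j) * v $ j) / c"
      by (simp add: sum_divide_distrib del: sum.lessThan_Suc sum.op_ivl_Suc)
    also have "(\<Sum>j<?N. A $$ (i, j) * v $ j) = (A *\<^sub>v v) $ i"
      using that A v(1) by (simp add: scalar_prod_def lessThan_atLeast0 del: sum.lessThan_Suc sum.op_ivl_Suc)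
    also have "\<dots> = lam * v $ i" using v that by simp
    finally show ?thesis using R(4)[OF that] by simp
  qed
  have B0: "B $$ (i, 0) = (if i = 0 then lam else 0)" if "i < ?N" for i
  proof -
    have "B $$ (i, 0) = (\<Sum>j<?N. R $$ (i, j) * (lam * R $$ (j, 0)))"
      unfolding B_def using that A R AR0
      by (simp add: scalar_prod_def lessThan_atLeast0 del: sum.lessThan_Suc sum.op_ivl_Suc)
    also have "\<dots> = lam * (R * R) $$ (i, 0)"
      using that R(1) by (simp add: scalar_prod_def lessThan_atLeast0 sum_distrib_left algebra_simps del: sum.lessThan_Suc sum.op_ivl_Suc)
    finally show ?thesis using that R(3) by simp
  qed
  have B0': "B $$ (0, i) = (if i = 0 then lam else 0)" if "i < ?N" for i
    using B0[OF that] arg_cong[OF B_sym, of "\<lambda>M. M $$ (0, i)"] B that by simp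
  define C where "C = mat n n (\<lambda>(i, j). B $$ (Suc i, Suc j))"
  have C: "C \<in> carrier_mat n n" by (simp add: C_def)
  have "B $$ (i, j) = B $$ (j, i)" if "i < ?N" "j < ?N" for i j
    using arg_cong[OF B_sym, of "\<lambda>M. M $$ (i, j)"] B that by simp
  hence "transpose_mat C = C" by (intro eq_matI) (auto simp: C_def)
  from Suc.IH[OF C this] obtain Q D where Q: "Q \<in> carrier_mat n n" "D \<in> carrier_mat n n"
    "transpose_mat Q * Q = 1\<^sub>m n" "diagonal_mat D" "C * Q = Q * D" by blast
  define L where "L = mat 1 1 (\<lambda>_. lam)"
  have L: "L \<in> carrier_mat 1 1" by (simp add: L_def)
  have Bblock: "B = four_block_mat L (0\<^sub>m 1 n) (0\<^sub>m n 1) C"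
  proof (rule eq_matI)
    fix i j assume "i < dim_row (four_block_mat L (0\<^sub>m 1 n) (0\<^sub>m n 1) C)"
      "j < dim_col (four_block_mat L (0\<^sub>m 1 n) (0\<^sub>m n 1) C)"
    hence ij: "i < ?N" "j < ?N" using L C by auto
    show "B $$ (i, j) = four_block_mat L (0\<^sub>m 1 n) (0\<^sub>m n 1) C $$ (i, j)"
      using ij L C B0 B0' by (cases i; cases j) (auto simp: C_def L_def)
  qed (use B L C in auto)
  define P where "P = four_block_mat (1\<^sub>m 1) (0\<^sub>m 1 n) (0\<^sub>m n 1) Q"
  define E where "E = four_block_mat L (0\<^sub>m 1 n) (0\<^sub>m n 1) D"
  have P: "P \<in> carrier_mat ?N ?N" and E: "E \<in> carrier_mat ?N ?N"
    using Q L unfolding P_def E_def by (auto intro!: carrier_matI)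
  have PP: "transpose_mat P * P = 1\<^sub>m ?N"
  proof -
    have "transpose_mat P = four_block_mat (1\<^sub>m 1) (0\<^sub>m 1 n) (0\<^sub>m n 1) (transpose_mat Q)"
      unfolding P_def using Q by (subst transpose_four_block_mat[of _ 1 1 _ n _ n]) auto
    hence "transpose_mat P * P = four_block_mat (1\<^sub>m 1) (0\<^sub>m 1 n) (0\<^sub>m n 1) (1\<^sub>m n)"
      unfolding P_def using Q by (simp add: mult_four_block_mat[of _ 1 1 _ n _ n _ _ 1 _ n])
    thus ?thesis by simp
  qed
  have BP: "B * P = P * E"
    unfolding Bblock P_def E_def using Q C L
    by (simp add: mult_four_block_mat[of _ 1 1 _ n _ n _ _ 1 _ n])
  have "A * (R * P) = (R * P) * E"
  proof -
    have "R * (B * P) = (R * R) * (A * (R * P))"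
      unfolding B_def using A R(1) P
      by (simp add: assoc_mult_mat[of _ ?N ?N _ ?N _ ?N])
    also have "\<dots> = A * (R * P)" using R A P by simp
    finally show ?thesis unfolding BP using R P E by (simp add: assoc_mult_mat[of _ ?N ?N _ ?N _ ?N])
  qed
  moreover have "transpose_mat (R * P) * (R * P) = 1\<^sub>m ?N"
  proof -
    have "transpose_mat (R * P) * (R * P) = transpose_mat P * ((R * R) * P)"
      using R(1,2) P by (simp add: transpose_mult[of _ ?N ?N _ ?N] assoc_mult_mat[of _ ?N ?N _ ?N _ ?N])
    thus ?thesis using R(3) PP P by simp
  qed
  moreover have "diagonal_mat E"
    using Q(2,4) L unfolding E_def diagonal_mat_def by (auto simp: L_def)
  ultimately show ?case using R(1) P E by (intro exI[of _ "R * P"] exI[of _ E]) auto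
qed

text \<open>\<open>U k\<close> is the \<open>k\<close>-th eigenvector. Norms use orthonormality,
  Parseval's identity uses completeness, so both are recorded. Plain functions instead of matrices
  keep later computations free of carriers.\<close>

definition eigenbasis :: "nat \<Rightarrow> (nat \<Rightarrow> nat \<Rightarrow> real) \<Rightarrow> (nat \<Rightarrow> real) \<Rightarrow> (nat \<Rightarrow> nat \<Rightarrow> real) \<Rightarrow> bool" where
  "eigenbasis n A lam U \<longleftrightarrow>
     (\<forall>k<n. \<forall>l<n. (\<Sum>i<n. U k i * U l i) = (if k = l then 1 else 0)) \<and>
     (\<forall>i<n. \<forall>j<n. (\<Sum>k<n. U k i * U k j) = (if i = j then 1 else 0)) \<and>
     (\<forall>k<n. \<forall>i<n. (\<Sum>j<n. A i j * U k j) = lam k * U k i)"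

text \<open>The factored characteristic polynomial comes along because the trace-norm is read off
  from its roots with multiplicity.\<close>

lemma symmetric_eigenbasis:
  assumes sym: "\<And>i j. i < n \<Longrightarrow> j < n \<Longrightarrow> A i j = A j i"
  obtains lam U where "eigenbasis n A lam U"
    "char_poly (mat n n (\<lambda>(i, j). A i j)) = (\<Prod>k\<leftarrow>[0..<n]. [:- lam k, 1:])"
proof -
  let ?A = "mat n n (\<lambda>(i, j). A i j)"
  have "transpose_mat ?A = ?A" using sym by (intro eq_matI) auto
  then obtain P D where P: "P \<in> carrier_mat n n" "D \<in> carrier_mat n n"
    "transpose_mat P * P = 1\<^sub>m n" "diagonal_mat D" "?A * P = P * D"
    using symmetric_diagonalization[of ?A n] by auto
  have PP: "P * transpose_mat P = 1\<^sub>m n"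
    using mat_mult_left_right_inverse[OF _ P(1) P(3)] P(1) by simp
  define lam where "lam k = D $$ (k, k)" for k
  define U where "U k i = P $$ (i, k)" for k i
  have "?A = P * D * transpose_mat P"
    using PP P(1,2) unfolding P(5)[symmetric] by (simp add: assoc_mult_mat[of _ n n _ n _ n])
  hence "similar_mat ?A D"
    using P PP unfolding similar_mat_def
    by (intro exI[of _ P] exI[of _ "transpose_mat P"] similar_mat_witI[of _ _ n]) auto
  hence "char_poly ?A = char_poly D" by (rule char_poly_similar)
  also have "\<dots> = (\<Prod>a\<leftarrow>diag_mat D. [:- a, 1:])"
    using P by (intro char_poly_upper_triangular[of _ n]) (auto simp: diagonal_mat_def)
  also have "diag_mat D = map lam [0..<n]"
    using P by (auto simp: diag_mat_def lam_def)
  finally have cp: "char_poly ?A = (\<Prod>k\<leftarrow>[0..<n]. [:- lam k, 1:])" by (simp add: o_def)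
  have "(\<Sum>i<n. U k i * U l i) = (if k = l then 1 else 0)" if "k < n" "l < n" for k l
    using arg_cong[OF P(3), of "\<lambda>M. M $$ (k, l)"] that P(1)
    by (simp add: scalar_prod_def lessThan_atLeast0 U_def)
  moreover have "(\<Sum>k<n. U k i * U k j) = (if i = j then 1 else 0)" if "i < n" "j < n" for i j
    using arg_cong[OF PP, of "\<lambda>M. M $$ (i, j)"] that P(1)
    by (simp add: scalar_prod_def lessThan_atLeast0 U_def)
  moreover have "(\<Sum>j<n. A i j * U k j) = lam k * U k i" if "k < n" "i < n" for k i
  proof -
    have "(\<Sum>j<n. A i j * U k j) = (?A * P) $$ (i, k)"
      using that P(1) by (simp add: scalar_prod_def lessThan_atLeast0 U_def)
    also have "\<dots> = (\<Sum>j<n. P $$ (i, j) * D $$ (j, k))"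
      unfolding P(5) using that P(1,2) by (simp add: scalar_prod_def lessThan_atLeast0)
    also have "\<dots> = (\<Sum>j<n. if j = k then lam k * U k i else 0)"
      using that P(2,4) by (intro sum.cong) (auto simp: diagonal_mat_def lam_def U_def)
    finally show ?thesis using that by simp
  qed
  ultimately have "eigenbasis n A lam U" unfolding eigenbasis_def by blast
  thus ?thesis using cp that by blast
qed

section \<open>Trace-norm duality\<close>

lemma eigenbasis_parseval:
  assumes "eigenbasis n A lam U"
  shows "(\<Sum>i<n. x i * y i) = (\<Sum>k<n. (\<Sum>i<n. x i * U k i) * (\<Sum>j<n. U k j * y j))"
proof -
  have "(\<Sum>k<n. (\<Sum>i<n. x i * U k i) * (\<Sum>j<n. U k j * y j))
      = (\<Sum>k<n. \<Sum>i<n. \<Sum>j<n. x i * y j * (U k i * U k j))"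
    by (simp add: sum_product algebra_simps)
  also have "\<dots> = (\<Sum>i<n. \<Sum>k<n. \<Sum>j<n. x i * y j * (U k i * U k j))"
    by (rule sum.swap)
  also have "\<dots> = (\<Sum>i<n. \<Sum>j<n. \<Sum>k<n. x i * y j * (U k i * U k j))"
    by (rule sum.cong[OF refl], rule sum.swap)
  also have "\<dots> = (\<Sum>i<n. \<Sum>j<n. x i * y j * (if i = j then 1 else 0))"
    using assms unfolding sum_distrib_left[symmetric] eigenbasis_def by (intro sum.cong) auto
  also have "\<dots> = (\<Sum>i<n. x i * y i)"
    by (intro sum.cong) (auto simp: if_distrib cong: if_cong)
  finally show ?thesis ..
qed

text \<open>For a unit eigenvector \<open>u\<close> of \<open>A^T A\<close>,
  \<open>|A u|^2 = <u, A^T A u>\<close> is the eigenvalue; its square root is therefore a singular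
  value.\<close>

lemma gram_eigenvalue:
  fixes A :: "nat \<Rightarrow> nat \<Rightarrow> real"
  assumes "eigenbasis m (\<lambda>j l. \<Sum>i<n. A i j * A i l) lam U" "k < m"
  shows "(\<Sum>i<n. (\<Sum>j<m. A i j * U k j)\<^sup>2) = lam k"
proof -
  have "(\<Sum>i<n. (\<Sum>j<m. A i j * U k j)\<^sup>2) = (\<Sum>i<n. \<Sum>j<m. \<Sum>l<m. U k j * (A i j * A i l * U k l))"
    by (simp add: power2_eq_square sum_product algebra_simps)
  also have "\<dots> = (\<Sum>j<m. \<Sum>i<n. \<Sum>l<m. U k j * (A i j * A i l * U k l))"
    by (rule sum.swap)
  also have "\<dots> = (\<Sum>j<m. \<Sum>l<m. \<Sum>i<n. U k j * (A i j * A i l * U k l))"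
    by (rule sum.cong[OF refl], rule sum.swap)
  also have "\<dots> = (\<Sum>j<m. U k j * (\<Sum>l<m. (\<Sum>i<n. A i j * A i l) * U k l))"
    by (simp add: sum_distrib_left sum_distrib_right)
  also have "\<dots> = (\<Sum>j<m. U k j * (lam k * U k j))"
    using assms unfolding eigenbasis_def by (intro sum.cong) auto
  also have "\<dots> = lam k * (\<Sum>j<m. U k j * U k j)"
    by (simp add: sum_distrib_left algebra_simps)
  also have "\<dots> = lam k" using assms by (simp add: eigenbasis_def)
  finally show ?thesis .
qed

lemma sum_list_singleton_mset: "(\<Sum>x\<leftarrow>xs. {#f x#}) = mset (map f xs)"
  by (induction xs) auto

text \<open>In the eigenbasis \<open>u_k\<close> of \<open>A^T A\<close> the pairing is the sum of
  \<open><A u_k, B u_k>\<close>. By Cauchy-Schwarz each term is at most the singular value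
  \<open>|A u_k|\<close> times \<open>c\<close>. The hypothesis on \<open>B\<close> says that its
  operator norm is at most \<open>c\<close>.\<close>

lemma trace_norm_duality:
  fixes B :: "nat \<Rightarrow> nat \<Rightarrow> real"
  assumes A: "A \<in> carrier_mat n m" and c: "0 \<le> c"
    and B: "\<And>v. (\<Sum>i<n. (\<Sum>j<m. B i j * v j)\<^sup>2) \<le> c\<^sup>2 * (\<Sum>j<m. (v j)\<^sup>2)"
  shows "(\<Sum>i<n. \<Sum>j<m. A $$ (i, j) * B i j) \<le> c * trace_norm A"
proof -
  define G where "G j l = (\<Sum>i<n. A $$ (i, j) * A $$ (i, l))" for j l
  obtain lam U where U: "eigenbasis m G lam U"
    and cp: "char_poly (mat m m (\<lambda>(i, j). G i j)) = (\<Prod>k\<leftarrow>[0..<m]. [:- lam k, 1:])"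
    by (rule symmetric_eigenbasis[of m G]) (auto simp: G_def mult.commute)
  have "transpose_mat A * A = mat m m (\<lambda>(i, j). G i j)"
    using A by (intro eq_matI) (auto simp: G_def scalar_prod_def lessThan_atLeast0)
  hence "singular_values A = image_mset sqrt (proots (\<Prod>x\<leftarrow>map (\<lambda>k. [:- lam k, 1:]) [0..<m]. x))"
    unfolding singular_values_def by (simp add: cp)
  also have "proots (\<Prod>x\<leftarrow>map (\<lambda>k. [:- lam k, 1:]) [0..<m]. x) = mset (map lam [0..<m])"
    by (subst proots_prod_list) (auto simp: o_def sum_list_singleton_mset)
  finally have tn: "trace_norm A = (\<Sum>k<m. sqrt (lam k))"
    unfolding trace_norm_def
    by (simp add: lessThan_atLeast0 sum_mset_sum_list interv_sum_list_conv_sum_set_nat o_def flip: mset_map)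
  have "(\<Sum>i<n. \<Sum>j<m. A $$ (i, j) * B i j)
      = (\<Sum>i<n. \<Sum>k<m. (\<Sum>j<m. A $$ (i, j) * U k j) * (\<Sum>j<m. U k j * B i j))"
    by (intro sum.cong refl eigenbasis_parseval[OF U])
  also have "\<dots> = (\<Sum>k<m. \<Sum>i<n. (\<Sum>j<m. A $$ (i, j) * U k j) * (\<Sum>j<m. B i j * U k j))"
    by (subst sum.swap) (simp add: mult.commute)
  also have "\<dots> \<le> (\<Sum>k<m. sqrt (lam k) * c)"
  proof (intro sum_mono)
    fix k assume "k \<in> {..<m}"
    hence k: "k < m" by simp
    let ?x = "\<lambda>i. \<Sum>j<m. A $$ (i, j) * U k j" and ?y = "\<lambda>i. \<Sum>j<m. B i j * U k j"
    have "(\<Sum>i<n. (?y i)\<^sup>2) \<le> c\<^sup>2"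
      using B[of "U k"] U k by (simp add: eigenbasis_def power2_eq_square)
    hence "L2_set ?y {..<n} \<le> c"
      unfolding L2_set_def using c by (simp add: real_le_lsqrt sum_nonneg)
    moreover have "L2_set ?x {..<n} = sqrt (lam k)"
      unfolding L2_set_def using gram_eigenvalue[OF U[unfolded G_def[abs_def]] k] by simp
    moreover have "(\<Sum>i<n. ?x i * ?y i) \<le> L2_set ?x {..<n} * L2_set ?y {..<n}"
      by (rule order_trans[OF _ L2_set_mult_ineq]) (intro sum_mono, simp add: abs_mult[symmetric])
    ultimately show "(\<Sum>i<n. ?x i * ?y i) \<le> sqrt (lam k) * c"
      by (smt (verit) L2_set_nonneg mult_left_mono)
  qed
  also have "\<dots> = c * trace_norm A" unfolding tn by (simp add: sum_distrib_left mult.commute)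
  finally show ?thesis .
qed

text \<open>Multiplying \<open>X\<close> and dividing \<open>C\<close> entrywise by the same square
  roots of weights leaves the pairing unchanged, and the scaled \<open>X\<close> has trace-norm at
  most \<open>sqrt r\<close>.\<close>

lemma weighted_class_duality:
  fixes C :: "nat \<Rightarrow> nat \<Rightarrow> real"
  assumes X: "X \<in> weighted_class n m r qr qc" and c: "0 \<le> c"
    and qr: "\<And>i. i < n \<Longrightarrow> 0 < qr i" and qc: "\<And>j. j < m \<Longrightarrow> 0 < qc j"
    and C: "\<And>v. (\<Sum>i<n. (\<Sum>j<m. C i j / sqrt (qr i * qc j) * v j)\<^sup>2) \<le> c\<^sup>2 * (\<Sum>j<m. (v j)\<^sup>2)"
  shows "(\<Sum>i<n. \<Sum>j<m. X $$ (i, j) * C i j) \<le> c * sqrt r"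
proof -
  let ?W = "mat_diag n (\<lambda>i. sqrt (qr i)) * X * mat_diag m (\<lambda>j. sqrt (qc j))"
  have Xc: "X \<in> carrier_mat n m" and tn: "trace_norm ?W \<le> sqrt r"
    using X by (auto simp: weighted_class_def weighted_trace_norm_def)
  have W: "?W \<in> carrier_mat n m"
    using Xc by (intro mult_carrier_mat[of _ n m] mult_carrier_mat[of _ n n]) auto
  have ent: "?W $$ (i, j) * (C i j / sqrt (qr i * qc j)) = X $$ (i, j) * C i j" if "i < n" "j < m" for i j
  proof -
    have "?W $$ (i, j) = sqrt (qr i) * X $$ (i, j) * sqrt (qc j)"
      using that Xc by (simp add: mat_diag_mult_left[OF Xc] mat_diag_mult_right[OF mat_carrier])
    thus ?thesis using qr[OF that(1)] qc[OF that(2)] by (simp add: real_sqrt_mult)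
  qed
  have "(\<Sum>i<n. \<Sum>j<m. X $$ (i, j) * C i j) = (\<Sum>i<n. \<Sum>j<m. ?W $$ (i, j) * (C i j / sqrt (qr i * qc j)))"
    using ent by simp
  also have "\<dots> \<le> c * trace_norm ?W" by (rule trace_norm_duality[OF W c C])
  also have "\<dots> \<le> c * sqrt r" using tn c by (rule mult_left_mono)
  finally show ?thesis .
qed

section \<open>Means over finite product distributions\<close>

text \<open>The mean over \<open>s\<close> independent draws with weights \<open>w\<close>, as a
  finite sum: samples and signs share one calculus and integrability never arises.\<close>

definition product_mean :: "nat \<Rightarrow> 'a set \<Rightarrow> ('a \<Rightarrow> real) \<Rightarrow> ((nat \<Rightarrow> 'a) \<Rightarrow> real) \<Rightarrow> real" where
  "product_mean s A w f = (\<Sum>z\<in>{..<s} \<rightarrow>\<^sub>E A. (\<Prod>t<s. w (z t)) * f z)"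

lemma product_mean_mono:
  assumes "\<And>a. a \<in> A \<Longrightarrow> 0 \<le> w a" "\<And>z. z \<in> {..<s} \<rightarrow>\<^sub>E A \<Longrightarrow> f z \<le> g z"
  shows "product_mean s A w f \<le> product_mean s A w g"
  unfolding product_mean_def using assms
  by (intro sum_mono mult_left_mono prod_nonneg) (auto simp: PiE_iff)

lemma product_mean_cong:
  "(\<And>z. z \<in> {..<s} \<rightarrow>\<^sub>E A \<Longrightarrow> f z = g z) \<Longrightarrow> product_mean s A w f = product_mean s A w g"
  by (simp add: product_mean_def)

lemma product_mean_add:
  "product_mean s A w (\<lambda>z. f z + g z) = product_mean s A w f + product_mean s A w g"
  by (simp add: product_mean_def sum.distrib distrib_left)

lemma product_mean_diff:
  "product_mean s A w (\<lambda>z. f z - g z) = product_mean s A w f - product_mean s A w g"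
  by (simp add: product_mean_def sum_subtractf right_diff_distrib)

lemma product_mean_cmult: "product_mean s A w (\<lambda>z. c * f z) = c * product_mean s A w f"
  by (simp add: product_mean_def sum_distrib_left mult.left_commute)

lemma product_mean_sum:
  "product_mean s A w (\<lambda>z. \<Sum>i\<in>I. f i z) = (\<Sum>i\<in>I. product_mean s A w (f i))"
  by (simp add: product_mean_def sum_distrib_left sum.swap[of _ I])

lemma product_mean_swap:
  "product_mean s A w (\<lambda>z. product_mean s' B v (f z))
   = product_mean s' B v (\<lambda>y. product_mean s A w (\<lambda>z. f z y))"
  unfolding product_mean_def sum_distrib_left
  by (subst sum.swap) (simp add: mult.left_commute)

lemma product_mean_prod:
  assumes "finite A"
  shows "product_mean s A w (\<lambda>z. \<Prod>t<s. h t (z t)) = (\<Prod>t<s. \<Sum>a\<in>A. w a * h t a)"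
  using assms by (simp add: product_mean_def prod_sum_PiE prod.distrib)

lemma product_mean_const [simp]:
  assumes "finite A" "sum w A = 1"
  shows "product_mean s A w (\<lambda>_. c) = c"
  using product_mean_prod[OF assms(1), of s w "\<lambda>_ _. 1"] product_mean_cmult[of s A w c "\<lambda>_. 1"] assms(2)
  by simp

lemma product_mean_coordinate:
  assumes "finite A" "sum w A = 1" "t < s"
  shows "product_mean s A w (\<lambda>z. h (z t)) = (\<Sum>a\<in>A. w a * h a)"
proof -
  have "product_mean s A w (\<lambda>z. h (z t)) = product_mean s A w (\<lambda>z. \<Prod>u<s. if u = t then h (z u) else 1)"
    using assms(3) by (simp add: prod.delta)
  also have "\<dots> = (\<Prod>u<s. \<Sum>a\<in>A. w a * (if u = t then h a else 1))"
    by (rule product_mean_prod[OF assms(1)])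
  also have "\<dots> = (\<Prod>u<s. if u = t then \<Sum>a\<in>A. w a * h a else 1)"
    using assms(2) by (intro prod.cong) auto
  finally show ?thesis using assms(3) by (simp add: prod.delta)
qed

section \<open>Random signs and their symmetries\<close>

abbreviation rademacher_mean :: "nat \<Rightarrow> ((nat \<Rightarrow> real) \<Rightarrow> real) \<Rightarrow> real" where
  "rademacher_mean s \<equiv> product_mean s {- 1, 1} (\<lambda>_. 1 / 2)"

lemma signs_cases: "\<sigma> \<in> {..<s} \<rightarrow>\<^sub>E {- 1, 1 :: real} \<Longrightarrow> t < s \<Longrightarrow> \<sigma> t = - 1 \<or> \<sigma> t = 1"
  by (auto simp: PiE_iff)

lemma rademacher_mean_flip:
  assumes "t < s"
  shows "rademacher_mean s (\<lambda>\<sigma>. f (\<sigma>(t := - \<sigma> t))) = rademacher_mean s f"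
proof -
  let ?signs = "{..<s} \<rightarrow>\<^sub>E {- 1, 1 :: real}"
  have "\<sigma>(t := - \<sigma> t) \<in> ?signs" if "\<sigma> \<in> ?signs" for \<sigma>
    using that assms signs_cases[OF that assms] by (auto simp: PiE_iff extensional_def)
  hence "(\<Sum>\<sigma>\<in>?signs. (1 / 2) ^ s * f (\<sigma>(t := - \<sigma> t))) = (\<Sum>\<sigma>\<in>?signs. (1 / 2) ^ s * f \<sigma>)"
    by (intro sum.reindex_bij_witness[of _ "\<lambda>\<sigma>. \<sigma>(t := - \<sigma> t)" "\<lambda>\<sigma>. \<sigma>(t := - \<sigma> t)"]) auto
  thus ?thesis by (simp add: product_mean_def)
qed

text \<open>Negation is an involution of the sign vectors. It is restricted to \<open>{..<s}\<close>
  because they are extensional, with the value \<open>undefined\<close> elsewhere.\<close>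

lemma rademacher_mean_uminus:
  "rademacher_mean s (\<lambda>\<sigma>. f (\<lambda>t\<in>{..<s}. - \<sigma> t)) = rademacher_mean s f"
proof -
  let ?signs = "{..<s} \<rightarrow>\<^sub>E {- 1, 1 :: real}"
  have "(\<lambda>t\<in>{..<s}. - \<sigma> t) \<in> ?signs" if "\<sigma> \<in> ?signs" for \<sigma>
    using signs_cases[OF that] by (auto simp: PiE_iff)
  moreover have "(\<lambda>t\<in>{..<s}. - (\<lambda>t\<in>{..<s}. - \<sigma> t) t) = \<sigma>" if "\<sigma> \<in> ?signs" for \<sigma>
    using that by (auto simp: PiE_iff extensional_def)
  ultimately have "(\<Sum>\<sigma>\<in>?signs. (1 / 2) ^ s * f (\<lambda>t\<in>{..<s}. - \<sigma> t)) = (\<Sum>\<sigma>\<in>?signs. (1 / 2) ^ s * f \<sigma>)"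
    by (intro sum.reindex_bij_witness[of _ "\<lambda>\<sigma>. \<lambda>t\<in>{..<s}. - \<sigma> t" "\<lambda>\<sigma>. \<lambda>t\<in>{..<s}. - \<sigma> t"]) auto
  thus ?thesis by (simp add: product_mean_def)
qed

text \<open>Conditioning on all signs but \<open>t\<close>, expressed without conditional
  expectations.\<close>

lemma rademacher_mean_symmetrize:
  assumes "t < s"
  shows "rademacher_mean s f = rademacher_mean s (\<lambda>\<sigma>. (f \<sigma> + f (\<sigma>(t := - \<sigma> t))) / 2)"
  using rademacher_mean_flip[OF assms, of f]
    product_mean_cmult[of s "{- 1, 1}" "\<lambda>_. 1 / 2" "1 / 2" "\<lambda>\<sigma>. f \<sigma> + f (\<sigma>(t := - \<sigma> t))"]
  by (simp add: product_mean_add)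

section \<open>Moments of Rademacher sums of symmetric matrices\<close>

text \<open>Both sides compare with the \<open>r\<close>-th power of the larger absolute value;
  evenness of \<open>r\<close> removes the absolute values on the right. It tames the mixed
  monomials in a factored difference of powers.\<close>

lemma even_power_interpolation:
  fixes x y :: real
  assumes "even r" "q \<le> r"
  shows "x ^ q * y ^ (r - q) \<le> x ^ r + y ^ r"
proof -
  let ?m = "max \<bar>x\<bar> \<bar>y\<bar>"
  have "x ^ q * y ^ (r - q) \<le> \<bar>x\<bar> ^ q * \<bar>y\<bar> ^ (r - q)"
    by (metis abs_ge_self abs_mult power_abs)
  also have "\<dots> \<le> ?m ^ q * ?m ^ (r - q)"
    by (intro mult_mono power_mono) auto
  also have "\<dots> = ?m ^ r" using assms by (simp flip: power_add)
  also have "\<dots> \<le> \<bar>x\<bar> ^ r + \<bar>y\<bar> ^ r" by (auto simp: max_def)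
  also have "\<dots> = x ^ r + y ^ r" using assms by (simp add: power_even_abs)
  finally show ?thesis .
qed

lemma symmetric_form:
  fixes A :: "nat \<Rightarrow> nat \<Rightarrow> real"
  assumes "\<And>i j. i < n \<Longrightarrow> j < n \<Longrightarrow> A i j = A j i"
  shows "(\<Sum>i<n. x i * (\<Sum>j<n. A i j * y j)) = (\<Sum>i<n. (\<Sum>j<n. A i j * x j) * y i)"
proof -
  have "(\<Sum>i<n. x i * (\<Sum>j<n. A i j * y j)) = (\<Sum>j<n. \<Sum>i<n. x i * (A i j * y j))"
    unfolding sum_distrib_left by (rule sum.swap)
  also have "\<dots> = (\<Sum>i<n. (\<Sum>j<n. A i j * x j) * y i)"
    unfolding sum_distrib_right using assms by (intro sum.cong refl) auto
  finally show ?thesis .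
qed

text \<open>In the eigenbases $u$ of $W$ and $v$ of $Y$, the trace of $H (W^{r+1} - Y^{r+1})$ is a sum of
  terms $(\lambda_u^{r+1} - \mu_v^{r+1}) \langle u, v\rangle \langle u, H v\rangle$, and
  $(\lambda_u - \mu_v) \langle u, v\rangle = 2 \langle u, H v\rangle$.\<close>

lemma trace_power_difference:
  fixes H W Y :: "nat \<Rightarrow> nat \<Rightarrow> real"
  assumes W: "eigenbasis n W lam U" and Y: "eigenbasis n Y mu V" and r: "even r"
    and H_sym: "\<And>i j. i < n \<Longrightarrow> j < n \<Longrightarrow> H i j = H j i"
    and W_sym: "\<And>i j. i < n \<Longrightarrow> j < n \<Longrightarrow> W i j = W j i"
    and WY: "\<And>i j. i < n \<Longrightarrow> j < n \<Longrightarrow> W i j - Y i j = 2 * H i j"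
  shows "(\<Sum>k<n. lam k ^ Suc r * (\<Sum>i<n. U k i * (\<Sum>j<n. H i j * U k j)))
       - (\<Sum>k<n. mu k ^ Suc r * (\<Sum>i<n. V k i * (\<Sum>j<n. H i j * V k j)))
     \<le> real (2 * Suc r) * ((\<Sum>k<n. lam k ^ r * (\<Sum>i<n. (\<Sum>j<n. H i j * U k j)\<^sup>2))
                   + (\<Sum>k<n. mu k ^ r * (\<Sum>i<n. (\<Sum>j<n. H i j * V k j)\<^sup>2)))"
proof -
  define a where "a k l = (\<Sum>i<n. U k i * V l i)" for k l
  define h where "h k l = (\<Sum>i<n. U k i * (\<Sum>j<n. H i j * V l j))" for k l
  have h': "h k l = (\<Sum>i<n. (\<Sum>j<n. H i j * U k j) * V l i)" for k l
    unfolding h_def by (rule symmetric_form) (rule H_sym)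
  have UU: "(\<Sum>i<n. U k i * (\<Sum>j<n. H i j * U k j)) = (\<Sum>l<n. a k l * h k l)" if "k < n" for k
    by (rule trans[OF eigenbasis_parseval[OF Y]]) (simp add: a_def h' mult.commute)
  have VV: "(\<Sum>i<n. V l i * (\<Sum>j<n. H i j * V l j)) = (\<Sum>k<n. a k l * h k l)" if "l < n" for l
    by (rule trans[OF eigenbasis_parseval[OF W]]) (simp add: a_def h_def mult.commute)
  have HU: "(\<Sum>i<n. (\<Sum>j<n. H i j * U k j)\<^sup>2) = (\<Sum>l<n. (h k l)\<^sup>2)" for k
    unfolding power2_eq_square
    by (rule trans[OF eigenbasis_parseval[OF Y]]) (simp add: h' mult.commute)
  have HV: "(\<Sum>i<n. (\<Sum>j<n. H i j * V l j)\<^sup>2) = (\<Sum>k<n. (h k l)\<^sup>2)" for l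
    unfolding power2_eq_square
    by (rule trans[OF eigenbasis_parseval[OF W]]) (simp add: h_def mult.commute)
  have diff: "(lam k - mu l) * a k l = 2 * h k l" if "k < n" "l < n" for k l
  proof -
    have "lam k * a k l = (\<Sum>i<n. (\<Sum>j<n. W i j * U k j) * V l i)"
      using W that by (simp add: a_def eigenbasis_def sum_distrib_left mult.assoc)
    also have "\<dots> = (\<Sum>i<n. U k i * (\<Sum>j<n. W i j * V l j))"
      by (rule symmetric_form[symmetric]) (rule W_sym)
    finally have "lam k * a k l = (\<Sum>i<n. U k i * (\<Sum>j<n. W i j * V l j))" .
    moreover have "mu l * a k l = (\<Sum>i<n. U k i * (\<Sum>j<n. Y i j * V l j))"
      using Y that by (simp add: a_def eigenbasis_def sum_distrib_left algebra_simps)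
    ultimately have "(lam k - mu l) * a k l = (\<Sum>i<n. U k i * (\<Sum>j<n. (W i j - Y i j) * V l j))"
      by (simp add: algebra_simps sum_subtractf)
    also have "\<dots> = 2 * h k l" using WY by (simp add: h_def sum_distrib_left mult_ac)
    finally show ?thesis .
  qed
  have term_le: "(lam k ^ Suc r - mu l ^ Suc r) * (a k l * h k l)
      \<le> real (2 * Suc r) * (lam k ^ r + mu l ^ r) * (h k l)\<^sup>2" if "k < n" "l < n" for k l
  proof -
    \<comment> \<open>Factoring \<open>lam - mu\<close> out of the difference of powers turns
      \<open>a * h\<close> into \<open>2 * h^2\<close>; \<open>Suc r\<close> mixed monomials remain,
      which gives the constant \<open>2 * Suc r\<close>.\<close>
    have "(lam k ^ Suc r - mu l ^ Suc r) * (a k l * h k l)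
        = ((lam k - mu l) * a k l) * (h k l * (\<Sum>q<Suc r. mu l ^ (Suc r - Suc q) * lam k ^ q))"
      unfolding power_diff_sumr2 by (simp add: algebra_simps)
    also have "\<dots> = 2 * (h k l)\<^sup>2 * (\<Sum>q<Suc r. lam k ^ q * mu l ^ (r - q))"
      unfolding diff[OF that] by (simp add: power2_eq_square mult.commute algebra_simps)
    also have "\<dots> \<le> 2 * (h k l)\<^sup>2 * (\<Sum>q<Suc r. lam k ^ r + mu l ^ r)"
      by (intro mult_left_mono sum_mono even_power_interpolation r) auto
    finally show ?thesis by (simp add: algebra_simps)
  qed
  have "(\<Sum>k<n. lam k ^ Suc r * (\<Sum>i<n. U k i * (\<Sum>j<n. H i j * U k j)))
       - (\<Sum>l<n. mu l ^ Suc r * (\<Sum>i<n. V l i * (\<Sum>j<n. H i j * V l j)))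
     = (\<Sum>k<n. \<Sum>l<n. lam k ^ Suc r * (a k l * h k l)) - (\<Sum>l<n. \<Sum>k<n. mu l ^ Suc r * (a k l * h k l))"
    unfolding sum_distrib_left[symmetric] by (simp add: UU VV del: power_Suc)
  also have "\<dots> = (\<Sum>k<n. \<Sum>l<n. (lam k ^ Suc r - mu l ^ Suc r) * (a k l * h k l))"
    by (subst (2) sum.swap) (simp add: sum_subtractf[symmetric] left_diff_distrib del: power_Suc)
  also have "\<dots> \<le> (\<Sum>k<n. \<Sum>l<n. real (2 * Suc r) * (lam k ^ r + mu l ^ r) * (h k l)\<^sup>2)"
    by (intro sum_mono term_le) auto
  also have "\<dots> = real (2 * Suc r) * ((\<Sum>k<n. \<Sum>l<n. lam k ^ r * (h k l)\<^sup>2) + (\<Sum>k<n. \<Sum>l<n. mu l ^ r * (h k l)\<^sup>2))"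
    by (simp only: sum_distrib_left sum.distrib[symmetric] distrib_left distrib_right mult.assoc)
  also have "(\<Sum>k<n. \<Sum>l<n. mu l ^ r * (h k l)\<^sup>2) = (\<Sum>l<n. \<Sum>k<n. mu l ^ r * (h k l)\<^sup>2)"
    by (rule sum.swap)
  finally show ?thesis unfolding HU HV sum_distrib_left .
qed

text \<open>A discrete integration by parts: one factor of the random sum is traded against the
  sensitivity of the rest to its own sign. The variance hypothesis, applied to each unit
  eigenvector, then collapses the sum over \<open>t\<close> to \<open>M\<close>, so two powers of
  the matrix cost \<open>2 * Suc r * M\<close>.\<close>

lemma rademacher_trace_moment_step:
  fixes H :: "nat \<Rightarrow> nat \<Rightarrow> nat \<Rightarrow> real" and M :: real
  assumes H_sym: "\<And>t i j. t < s \<Longrightarrow> i < n \<Longrightarrow> j < n \<Longrightarrow> H t i j = H t j i"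
    and basis: "\<And>\<sigma>. eigenbasis n (\<lambda>i j. \<Sum>t<s. \<sigma> t * H t i j) (lam \<sigma>) (U \<sigma>)"
    and var: "\<And>x. (\<Sum>t<s. \<Sum>i<n. (\<Sum>j<n. H t i j * x j)\<^sup>2) \<le> M * (\<Sum>i<n. (x i)\<^sup>2)"
    and r: "even r"
  shows "rademacher_mean s (\<lambda>\<sigma>. \<Sum>k<n. lam \<sigma> k ^ Suc (Suc r))
      \<le> real (2 * Suc r) * M * rademacher_mean s (\<lambda>\<sigma>. \<Sum>k<n. lam \<sigma> k ^ r)"
proof -
  define g where "g t \<sigma> = (\<Sum>k<n. lam \<sigma> k ^ Suc r * (\<Sum>i<n. U \<sigma> k i * (\<Sum>j<n. H t i j * U \<sigma> k j)))" for t \<sigma>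
  define \<Phi> where "\<Phi> t \<sigma> = (\<Sum>k<n. lam \<sigma> k ^ r * (\<Sum>i<n. (\<Sum>j<n. H t i j * U \<sigma> k j)\<^sup>2))" for t \<sigma>
  have trace: "(\<Sum>k<n. lam \<sigma> k ^ Suc (Suc r)) = (\<Sum>t<s. \<sigma> t * g t \<sigma>)" for \<sigma>
  proof -
    have "lam \<sigma> k = (\<Sum>t<s. \<sigma> t * (\<Sum>i<n. U \<sigma> k i * (\<Sum>j<n. H t i j * U \<sigma> k j)))" if k: "k < n" for k
    proof -
      have "lam \<sigma> k = (\<Sum>i<n. U \<sigma> k i * (lam \<sigma> k * U \<sigma> k i))"
        using basis[of \<sigma>] k by (simp add: eigenbasis_def sum_distrib_left[symmetric] mult.left_commute)
      also have "\<dots> = (\<Sum>i<n. U \<sigma> k i * (\<Sum>j<n. (\<Sum>t<s. \<sigma> t * H t i j) * U \<sigma> k j))"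
        using basis[of \<sigma>] k by (simp add: eigenbasis_def)
      also have "\<dots> = (\<Sum>i<n. \<Sum>j<n. \<Sum>t<s. \<sigma> t * (U \<sigma> k i * (H t i j * U \<sigma> k j)))"
        by (simp add: sum_distrib_left sum_distrib_right algebra_simps)
      also have "\<dots> = (\<Sum>i<n. \<Sum>t<s. \<Sum>j<n. \<sigma> t * (U \<sigma> k i * (H t i j * U \<sigma> k j)))"
        by (rule sum.cong[OF refl], rule sum.swap)
      also have "\<dots> = (\<Sum>t<s. \<Sum>i<n. \<Sum>j<n. \<sigma> t * (U \<sigma> k i * (H t i j * U \<sigma> k j)))"
        by (rule sum.swap)
      finally show ?thesis by (simp add: sum_distrib_left)
    qed
    hence "(\<Sum>k<n. lam \<sigma> k ^ Suc r * lam \<sigma> k)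
       = (\<Sum>k<n. lam \<sigma> k ^ Suc r * (\<Sum>t<s. \<sigma> t * (\<Sum>i<n. U \<sigma> k i * (\<Sum>j<n. H t i j * U \<sigma> k j))))"
      by (intro sum.cong refl arg_cong2[of _ _ _ _ "(*)"]) auto
    also have "\<dots> = (\<Sum>t<s. \<sigma> t * g t \<sigma>)"
      unfolding g_def sum_distrib_left[of "lam \<sigma> _ ^ Suc r" _ "{..<s}"]
      by (subst sum.swap) (simp add: sum_distrib_left mult.left_commute)
    finally show ?thesis by (simp add: mult.commute)
  qed
  have "rademacher_mean s (\<lambda>\<sigma>. \<sigma> t * g t \<sigma>) \<le> real (2 * Suc r) * rademacher_mean s (\<Phi> t)" if t: "t < s" for t
  proof -
    let ?fl = "\<lambda>\<sigma>::nat \<Rightarrow> real. \<sigma>(t := - \<sigma> t)"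
    have "rademacher_mean s (\<lambda>\<sigma>. \<sigma> t * g t \<sigma>)
        = rademacher_mean s (\<lambda>\<sigma>. (\<sigma> t * g t \<sigma> + - \<sigma> t * g t (?fl \<sigma>)) / 2)"
      using rademacher_mean_symmetrize[OF t, of "\<lambda>\<sigma>. \<sigma> t * g t \<sigma>"] by simp
    also have "\<dots> \<le> rademacher_mean s (\<lambda>\<sigma>. real (Suc r) * (\<Phi> t \<sigma> + \<Phi> t (?fl \<sigma>)))"
    proof (rule product_mean_mono)
      fix \<sigma> assume \<sigma>: "\<sigma> \<in> {..<s} \<rightarrow>\<^sub>E {- 1, 1 :: real}"
      have sq: "\<sigma> t * \<sigma> t = 1" using signs_cases[OF \<sigma> t] by auto
      let ?S = "\<lambda>\<sigma> i j. \<Sum>t<s. \<sigma> t * H t i j"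
      have S_diff: "?S \<sigma> i j - ?S (?fl \<sigma>) i j = 2 * (\<sigma> t * H t i j)" for i j
      proof -
        have "?S \<sigma> i j - ?S (?fl \<sigma>) i j = (\<Sum>u<s. if u = t then 2 * (\<sigma> t * H t i j) else 0)"
          unfolding sum_subtractf[symmetric] by (intro sum.cong) auto
        thus ?thesis using t by simp
      qed
      \<comment> \<open>Passing from \<open>H t\<close> to \<open>\<sigma> t * H t\<close>
        multiplies the linear term by \<open>\<sigma> t\<close> and leaves the squares alone, as
        \<open>(\<sigma> t)^2 = 1\<close>.\<close>
      have scale: "(\<Sum>k<n. f k * (\<Sum>i<n. u k i * (\<Sum>j<n. \<sigma> t * H t i j * u k j)))
          = \<sigma> t * (\<Sum>k<n. f k * (\<Sum>i<n. u k i * (\<Sum>j<n. H t i j * u k j)))" for f u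
        by (simp add: sum_distrib_left algebra_simps)
      have "(\<Sum>j<n. \<sigma> t * H t i j * x j)\<^sup>2 = (\<Sum>j<n. H t i j * x j)\<^sup>2" for i x
      proof -
        have "(\<Sum>j<n. \<sigma> t * H t i j * x j) = \<sigma> t * (\<Sum>j<n. H t i j * x j)"
          by (simp add: sum_distrib_left mult.assoc)
        thus ?thesis using sq by (simp add: power_mult_distrib power2_eq_square[of "\<sigma> t"])
      qed
      note sq' = this
      have "\<sigma> t * g t \<sigma> - \<sigma> t * g t (?fl \<sigma>) \<le> real (2 * Suc r) * (\<Phi> t \<sigma> + \<Phi> t (?fl \<sigma>))"
        using trace_power_difference[OF basis[of \<sigma>] basis[of "?fl \<sigma>"] r, of "\<lambda>i j. \<sigma> t * H t i j"]
          H_sym t S_diff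
        unfolding scale sq' g_def[symmetric] \<Phi>_def[symmetric] by simp
      thus "(\<sigma> t * g t \<sigma> + - \<sigma> t * g t (?fl \<sigma>)) / 2 \<le> real (Suc r) * (\<Phi> t \<sigma> + \<Phi> t (?fl \<sigma>))"
        by (simp add: algebra_simps)
    qed simp
    \<comment> \<open>Both copies of \<open>\<Phi> t\<close> have the same mean by flip invariance,
      which restores the factor 2 lost by averaging.\<close>
    also have "\<dots> = real (2 * Suc r) * rademacher_mean s (\<Phi> t)"
      by (simp only: product_mean_cmult product_mean_add rademacher_mean_flip[OF t]) simp
    finally show ?thesis .
  qed
  hence "rademacher_mean s (\<lambda>\<sigma>. \<Sum>k<n. lam \<sigma> k ^ Suc (Suc r)) \<le> (\<Sum>t<s. real (2 * Suc r) * rademacher_mean s (\<Phi> t))"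
    unfolding trace product_mean_sum by (intro sum_mono) auto
  also have "\<dots> = real (2 * Suc r) * rademacher_mean s (\<lambda>\<sigma>. \<Sum>t<s. \<Phi> t \<sigma>)"
    by (simp only: product_mean_sum sum_distrib_left)
  also have "\<dots> \<le> real (2 * Suc r) * rademacher_mean s (\<lambda>\<sigma>. M * (\<Sum>k<n. lam \<sigma> k ^ r))"
  proof (intro mult_left_mono product_mean_mono)
    fix \<sigma> :: "nat \<Rightarrow> real"
    have "(\<Sum>t<s. \<Phi> t \<sigma>) = (\<Sum>k<n. lam \<sigma> k ^ r * (\<Sum>t<s. \<Sum>i<n. (\<Sum>j<n. H t i j * U \<sigma> k j)\<^sup>2))"
      unfolding \<Phi>_def sum_distrib_left[of _ _ "{..<s}"] by (rule sum.swap)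
    also have "\<dots> \<le> (\<Sum>k<n. lam \<sigma> k ^ r * M)"
    proof (intro sum_mono mult_left_mono)
      fix k assume "k \<in> {..<n}"
      thus "(\<Sum>t<s. \<Sum>i<n. (\<Sum>j<n. H t i j * U \<sigma> k j)\<^sup>2) \<le> M"
        using var[of "U \<sigma> k"] basis[of \<sigma>] by (simp add: eigenbasis_def power2_eq_square)
    qed (use r in auto)
    finally show "(\<Sum>t<s. \<Phi> t \<sigma>) \<le> M * (\<Sum>k<n. lam \<sigma> k ^ r)"
      by (simp add: sum_distrib_left mult.commute)
  qed simp_all
  finally show ?thesis by (simp add: product_mean_cmult mult.assoc)
qed

text \<open>Iteration yields the factors \<open>2 * (2 * j + 1) * M\<close> for
  \<open>j < p\<close>, each at most \<open>4 * p * M\<close>; at \<open>p = 0\<close> the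
  convention \<open>0 ^ 0 = 1\<close> fits the empty product.\<close>

lemma rademacher_trace_moment:
  fixes H :: "nat \<Rightarrow> nat \<Rightarrow> nat \<Rightarrow> real" and M :: real
  assumes H_sym: "\<And>t i j. t < s \<Longrightarrow> i < n \<Longrightarrow> j < n \<Longrightarrow> H t i j = H t j i"
    and basis: "\<And>\<sigma>. eigenbasis n (\<lambda>i j. \<Sum>t<s. \<sigma> t * H t i j) (lam \<sigma>) (U \<sigma>)"
    and var: "\<And>x. (\<Sum>t<s. \<Sum>i<n. (\<Sum>j<n. H t i j * x j)\<^sup>2) \<le> M * (\<Sum>i<n. (x i)\<^sup>2)"
    and M: "0 \<le> M"
  shows "rademacher_mean s (\<lambda>\<sigma>. \<Sum>k<n. lam \<sigma> k ^ (2 * p)) \<le> (4 * real p * M) ^ p * real n"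
proof (induction p)
  case 0
  show ?case by simp
next
  case (Suc p)
  have "rademacher_mean s (\<lambda>\<sigma>. \<Sum>k<n. lam \<sigma> k ^ (2 * Suc p))
      \<le> real (2 * Suc (2 * p)) * M * rademacher_mean s (\<lambda>\<sigma>. \<Sum>k<n. lam \<sigma> k ^ (2 * p))"
    using rademacher_trace_moment_step[OF H_sym basis var, of "2 * p"] by simp
  also have "\<dots> \<le> real (2 * Suc (2 * p)) * M * ((4 * real p * M) ^ p * real n)"
    using M by (intro mult_left_mono Suc.IH) auto
  also have "\<dots> \<le> (real (4 * Suc p) * M) * ((real (4 * Suc p) * M) ^ p * real n)"
    using M by (intro mult_mono power_mono mult_right_mono) auto
  finally show ?case by (simp add: mult.assoc)
qed

text \<open>\<open>c\<close> is the largest absolute eigenvalue. Its even power is one summand of a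
  sum of nonnegative terms, which is how trace moments control the operator norm.\<close>

lemma eigenbasis_operator_bound:
  assumes basis: "eigenbasis n A lam U" and n: "0 < n"
    and sym: "\<And>i j. i < n \<Longrightarrow> j < n \<Longrightarrow> A i j = A j i"
  obtains c where "0 \<le> c" "\<And>x. (\<Sum>i<n. (\<Sum>j<n. A i j * x j)\<^sup>2) \<le> c\<^sup>2 * (\<Sum>i<n. (x i)\<^sup>2)"
    "\<And>p. c ^ (2 * p) \<le> (\<Sum>k<n. lam k ^ (2 * p))"
proof -
  define c where "c = Max ((\<lambda>k. \<bar>lam k\<bar>) ` {..<n})"
  have c_ge: "\<bar>lam k\<bar> \<le> c" if "k < n" for k
    unfolding c_def using that by (intro Max_ge) auto
  have "c \<in> (\<lambda>k. \<bar>lam k\<bar>) ` {..<n}" unfolding c_def using n by (intro Max_in) auto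
  then obtain k0 where k0: "k0 < n" "c = \<bar>lam k0\<bar>" by auto
  have "c ^ (2 * p) \<le> (\<Sum>k<n. lam k ^ (2 * p))" for p
  proof -
    have "c ^ (2 * p) = lam k0 ^ (2 * p)" by (simp add: k0 power_mult)
    also have "\<dots> \<le> (\<Sum>k<n. lam k ^ (2 * p))"
      using k0(1) by (intro member_le_sum) auto
    finally show ?thesis .
  qed
  moreover have "(\<Sum>i<n. (\<Sum>j<n. A i j * x j)\<^sup>2) \<le> c\<^sup>2 * (\<Sum>i<n. (x i)\<^sup>2)" for x
  proof -
    have coord: "(\<Sum>i<n. (\<Sum>j<n. A i j * x j) * U k i) = lam k * (\<Sum>i<n. x i * U k i)" if "k < n" for k
    proof -
      have "(\<Sum>i<n. (\<Sum>j<n. A i j * x j) * U k i) = (\<Sum>i<n. x i * (\<Sum>j<n. A i j * U k j))"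
        by (rule symmetric_form[symmetric]) (rule sym)
      also have "\<dots> = (\<Sum>i<n. x i * (lam k * U k i))"
        using basis that by (simp add: eigenbasis_def)
      finally show ?thesis by (simp add: sum_distrib_left mult.left_commute)
    qed
    have "(\<Sum>i<n. (\<Sum>j<n. A i j * x j)\<^sup>2) = (\<Sum>k<n. (\<Sum>i<n. (\<Sum>j<n. A i j * x j) * U k i)\<^sup>2)"
      unfolding power2_eq_square
      by (rule trans[OF eigenbasis_parseval[OF basis]]) (simp add: mult.commute)
    also have "\<dots> = (\<Sum>k<n. (lam k)\<^sup>2 * (\<Sum>i<n. x i * U k i)\<^sup>2)"
      using coord by (simp add: power_mult_distrib)
    also have "\<dots> \<le> (\<Sum>k<n. c\<^sup>2 * (\<Sum>i<n. x i * U k i)\<^sup>2)"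
    proof (intro sum_mono mult_right_mono)
      fix k assume "k \<in> {..<n}"
      thus "(lam k)\<^sup>2 \<le> c\<^sup>2" using c_ge[of k] by (intro abs_le_square_iff[THEN iffD1]) auto
    qed auto
    also have "\<dots> = c\<^sup>2 * (\<Sum>i<n. (x i)\<^sup>2)"
      unfolding sum_distrib_left[symmetric] power2_eq_square
      by (subst eigenbasis_parseval[OF basis, of x]) (simp add: mult.commute)
    finally show ?thesis .
  qed
  moreover have "0 \<le> c" using k0 by simp
  ultimately show ?thesis using that by blast
qed

text \<open>Markov-type bound: \<open>x \<le> a + a (x / a)\<^sup>2\<^sup>p\<close>, applied with \<open>a\<^sup>2 = 4 e p M\<close>, so that
  \<open>n \<le> e\<^sup>p\<close> absorbs the dimension.\<close>

lemma rademacher_operator_bound: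
  fixes H :: "nat \<Rightarrow> nat \<Rightarrow> nat \<Rightarrow> real" and M :: real
  assumes H_sym: "\<And>t i j. t < s \<Longrightarrow> i < n \<Longrightarrow> j < n \<Longrightarrow> H t i j = H t j i"
    and var: "\<And>x. (\<Sum>t<s. \<Sum>i<n. (\<Sum>j<n. H t i j * x j)\<^sup>2) \<le> M * (\<Sum>i<n. (x i)\<^sup>2)"
    and M: "0 < M" and n: "0 < n" and p: "0 < p" "real n \<le> exp (real p)"
  obtains c where "\<And>\<sigma>. 0 \<le> c \<sigma>"
    "\<And>\<sigma> x. (\<Sum>i<n. (\<Sum>j<n. (\<Sum>t<s. \<sigma> t * H t i j) * x j)\<^sup>2) \<le> (c \<sigma>)\<^sup>2 * (\<Sum>i<n. (x i)\<^sup>2)"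
    "rademacher_mean s c \<le> 2 * sqrt (4 * exp 1 * real p * M)"
proof -
  let ?S = "\<lambda>\<sigma> i j. \<Sum>t<s. \<sigma> t * H t i j"
  have S_sym: "?S \<sigma> i j = ?S \<sigma> j i" if "i < n" "j < n" for \<sigma> i j
    using H_sym that by (intro sum.cong) auto
  have "\<exists>lam U. eigenbasis n (?S \<sigma>) lam U" for \<sigma>
    by (rule symmetric_eigenbasis[of n "?S \<sigma>", OF S_sym]) auto
  \<comment> \<open>Eigenvalues and eigenvectors are packed into a pair so that a single choice
    makes both functions of the signs.\<close>
  hence "\<forall>\<sigma>. \<exists>q. eigenbasis n (?S \<sigma>) (fst q) (snd q)" by (intro allI) simp
  from choice[OF this] obtain q where q: "\<And>\<sigma>. eigenbasis n (?S \<sigma>) (fst (q \<sigma>)) (snd (q \<sigma>))"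
    by blast
  define lam U where "lam \<sigma> = fst (q \<sigma>)" and "U \<sigma> = snd (q \<sigma>)" for \<sigma>
  have basis: "eigenbasis n (?S \<sigma>) (lam \<sigma>) (U \<sigma>)" for \<sigma>
    unfolding lam_def U_def by (rule q)
  have "\<exists>c. 0 \<le> c \<and> (\<forall>x. (\<Sum>i<n. (\<Sum>j<n. ?S \<sigma> i j * x j)\<^sup>2) \<le> c\<^sup>2 * (\<Sum>i<n. (x i)\<^sup>2))
      \<and> c ^ (2 * p) \<le> (\<Sum>k<n. lam \<sigma> k ^ (2 * p))" for \<sigma>
    by (rule eigenbasis_operator_bound[OF basis[of \<sigma>] n S_sym]) blast+
  hence "\<forall>\<sigma>. \<exists>c. 0 \<le> c \<and> (\<forall>x. (\<Sum>i<n. (\<Sum>j<n. ?S \<sigma> i j * x j)\<^sup>2) \<le> c\<^sup>2 * (\<Sum>i<n. (x i)\<^sup>2))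
      \<and> c ^ (2 * p) \<le> (\<Sum>k<n. lam \<sigma> k ^ (2 * p))" by (rule allI)
  from choice[OF this] obtain c where c: "\<And>\<sigma>. 0 \<le> c \<sigma>"
    "\<And>\<sigma> x. (\<Sum>i<n. (\<Sum>j<n. ?S \<sigma> i j * x j)\<^sup>2) \<le> (c \<sigma>)\<^sup>2 * (\<Sum>i<n. (x i)\<^sup>2)"
    "\<And>\<sigma>. c \<sigma> ^ (2 * p) \<le> (\<Sum>k<n. lam \<sigma> k ^ (2 * p))" by blast
  define a where "a = sqrt (4 * exp 1 * real p * M)"
  have a: "0 < a" "a ^ (2 * p) = (4 * exp 1 * real p * M) ^ p"
    unfolding a_def power_mult using M p by auto
  have c_le: "c \<sigma> \<le> a + a / a ^ (2 * p) * (\<Sum>k<n. lam \<sigma> k ^ (2 * p))" for \<sigma>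
  proof -
    have "c \<sigma> / a \<le> 1 + (c \<sigma> / a) ^ (2 * p)"
    proof (cases "c \<sigma> / a \<le> 1")
      case True
      moreover have "0 \<le> (c \<sigma> / a) ^ (2 * p)" by (simp add: zero_le_even_power)
      ultimately show ?thesis by linarith
    next
      case False
      hence "c \<sigma> / a \<le> (c \<sigma> / a) ^ (2 * p)" using p by (intro self_le_power) auto
      thus ?thesis by simp
    qed
    hence "c \<sigma> \<le> a * (1 + (c \<sigma> / a) ^ (2 * p))" using a by (simp add: pos_divide_le_eq mult.commute)
    also have "\<dots> = a + a / a ^ (2 * p) * c \<sigma> ^ (2 * p)" by (simp add: power_divide distrib_left)
    also have "\<dots> \<le> a + a / a ^ (2 * p) * (\<Sum>k<n. lam \<sigma> k ^ (2 * p))"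
      using a(1) c(3) by (intro add_left_mono mult_left_mono) auto
    finally show ?thesis .
  qed
  have "rademacher_mean s c \<le> rademacher_mean s (\<lambda>\<sigma>. a + a / a ^ (2 * p) * (\<Sum>k<n. lam \<sigma> k ^ (2 * p)))"
    by (intro product_mean_mono c_le) simp
  also have "\<dots> = a + a / a ^ (2 * p) * rademacher_mean s (\<lambda>\<sigma>. \<Sum>k<n. lam \<sigma> k ^ (2 * p))"
    unfolding product_mean_add product_mean_cmult by simp
  also have "\<dots> \<le> a + a / a ^ (2 * p) * ((4 * real p * M) ^ p * real n)"
    using a M by (intro add_left_mono mult_left_mono rademacher_trace_moment[OF H_sym basis var]) auto
  also have "\<dots> = a + a * (n / exp p)"
  proof -
    have "(4 * exp 1 * real p * M) ^ p = exp p * (4 * real p * M) ^ p"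
      by (simp add: power_mult_distrib exp_of_nat_mult[symmetric])
    thus ?thesis unfolding a(2) using M p by simp
  qed
  also have "\<dots> \<le> a + a * 1" using a p by (intro add_left_mono mult_left_mono) auto
  finally have "rademacher_mean s c \<le> 2 * sqrt (4 * exp 1 * real p * M)" by (simp add: a_def)
  thus ?thesis using that c by blast
qed

section \<open>Contraction and symmetrization\<close>

text \<open>Let \<open>X\<close> and \<open>Z\<close> attain the two maxima on the left. Depending
  on the sign of \<open>b X - b Z\<close>, they are inserted on the right in this order or
  exchanged; \<open>g X + g Z\<close> is the same either way.\<close>

lemma Max_contraction_step:
  fixes a b g :: "'x \<Rightarrow> real"
  assumes F: "finite F" "F \<noteq> {}"
    and ab: "\<And>X Z. X \<in> F \<Longrightarrow> Z \<in> F \<Longrightarrow> \<bar>a X - a Z\<bar> \<le> \<bar>b X - b Z\<bar>"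
  shows "(MAX X\<in>F. g X + a X) + (MAX X\<in>F. g X - a X) \<le> (MAX X\<in>F. g X + b X) + (MAX X\<in>F. g X - b X)"
proof -
  have attained: "\<exists>X\<in>F. (MAX X\<in>F. h X) = h X" for h :: "'x \<Rightarrow> real"
  proof -
    have "Max (h ` F) \<in> h ` F" using F by (intro Max_in) auto
    thus ?thesis by auto
  qed
  obtain X where X: "X \<in> F" "(MAX X\<in>F. g X + a X) = g X + a X" using attained by blast
  obtain Z where Z: "Z \<in> F" "(MAX X\<in>F. g X - a X) = g Z - a Z" using attained by blast
  have upper: "h X \<le> (MAX X\<in>F. h X)" "h Z \<le> (MAX X\<in>F. h X)" for h :: "'x \<Rightarrow> real"
    using F X Z by auto
  have "a X - a Z \<le> b X - b Z \<or> a X - a Z \<le> b Z - b X"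
    using ab[OF X(1) Z(1)] by linarith
  thus ?thesis
    using X(2) Z(2) upper[of "\<lambda>X. g X + b X"] upper[of "\<lambda>X. g X - b X"] by linarith
qed

text \<open>A hybrid argument: \<open>q k\<close> uses \<open>h\<close> in the coordinates below
  \<open>k\<close> and \<open>f\<close> in the others, and each step changes one coordinate after
  averaging over its sign. Only differences enter, so \<open>f\<close> needs no normalization at
  zero.\<close>

lemma rademacher_contraction:
  fixes f h :: "'x \<Rightarrow> nat \<Rightarrow> real"
  assumes F: "finite F" "F \<noteq> {}"
    and fh: "\<And>X Z t. X \<in> F \<Longrightarrow> Z \<in> F \<Longrightarrow> t < s \<Longrightarrow> \<bar>f X t - f Z t\<bar> \<le> \<bar>h X t - h Z t\<bar>"
  shows "rademacher_mean s (\<lambda>\<sigma>. MAX X\<in>F. \<Sum>t<s. \<sigma> t * f X t)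
    \<le> rademacher_mean s (\<lambda>\<sigma>. MAX X\<in>F. \<Sum>t<s. \<sigma> t * h X t)"
proof -
  define q where "q k X t = (if t < k then h X t else f X t)" for k X t
  define \<Psi> where "\<Psi> k \<sigma> = (MAX X\<in>F. \<Sum>t<s. \<sigma> t * q k X t)" for k \<sigma>
  have "rademacher_mean s (\<Psi> 0) \<le> rademacher_mean s (\<Psi> k)" if "k \<le> s" for k
    using that
  proof (induction k)
    case (Suc k)
    hence k: "k < s" by simp
    have "rademacher_mean s (\<Psi> k) \<le> rademacher_mean s (\<Psi> (Suc k))"
      unfolding rademacher_mean_symmetrize[OF k, of "\<Psi> _"]
    proof (rule product_mean_mono)
      fix \<sigma> assume \<sigma>: "\<sigma> \<in> {..<s} \<rightarrow>\<^sub>E {- 1, 1 :: real}"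
      define g where "g X = (\<Sum>t\<in>{..<s} - {k}. \<sigma> t * q k X t)" for X
      have split: "(\<Sum>t<s. \<sigma> t * q k X t) = g X + \<sigma> k * f X k"
        "(\<Sum>t<s. \<sigma> t * q (Suc k) X t) = g X + \<sigma> k * h X k"
        "(\<Sum>t<s. (\<sigma>(k := - \<sigma> k)) t * q k X t) = g X - \<sigma> k * f X k"
        "(\<Sum>t<s. (\<sigma>(k := - \<sigma> k)) t * q (Suc k) X t) = g X - \<sigma> k * h X k" for X
        unfolding g_def using k
        by (simp_all add: sum.remove[of _ k] q_def less_Suc_eq cong: sum.cong_simp)
      have "\<bar>\<sigma> k\<bar> = 1" using signs_cases[OF \<sigma> k] by auto
      hence "\<bar>\<sigma> k * f X k - \<sigma> k * f Z k\<bar> \<le> \<bar>\<sigma> k * h X k - \<sigma> k * h Z k\<bar>" if "X \<in> F" "Z \<in> F" for X Z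
        using fh[OF that k] by (simp add: abs_mult flip: right_diff_distrib)
      from Max_contraction_step[OF F, of "\<lambda>X. \<sigma> k * f X k" "\<lambda>X. \<sigma> k * h X k" g, OF this]
      show "(\<Psi> k \<sigma> + \<Psi> k (\<sigma>(k := - \<sigma> k))) / 2 \<le> (\<Psi> (Suc k) \<sigma> + \<Psi> (Suc k) (\<sigma>(k := - \<sigma> k))) / 2"
        unfolding \<Psi>_def split by simp
    qed simp
    thus ?case using Suc by simp
  qed simp
  hence "rademacher_mean s (\<Psi> 0) \<le> rademacher_mean s (\<Psi> s)" by simp
  moreover have "\<Psi> 0 = (\<lambda>\<sigma>. MAX X\<in>F. \<Sum>t<s. \<sigma> t * f X t)"
    "\<Psi> s = (\<lambda>\<sigma>. MAX X\<in>F. \<Sum>t<s. \<sigma> t * h X t)"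
    unfolding \<Psi>_def q_def by (intro ext arg_cong[where f = Max] image_cong refl sum.cong; simp)+
  ultimately show ?thesis by simp
qed

text \<open>Exchanging the coordinates in \<open>B\<close> between two independent samples is an
  involution on pairs. It may change either weight but preserves their product.\<close>

lemma swapped_product_mean:
  fixes G :: "(nat \<Rightarrow> 'a) \<Rightarrow> (nat \<Rightarrow> 'a) \<Rightarrow> real" and B :: "nat set"
  defines "sw \<equiv> \<lambda>(z :: nat \<Rightarrow> 'a) z' t. if t \<in> B then z' t else z t"
  shows "product_mean s A w (\<lambda>z. product_mean s A w (\<lambda>z'. G (sw z z') (sw z' z)))
    = product_mean s A w (\<lambda>z. product_mean s A w (\<lambda>z'. G z z'))"
proof -
  let ?P = "{..<s} \<rightarrow>\<^sub>E A"
  let ?W = "\<lambda>z. \<Prod>t<s. w (z t)"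
  have mem: "sw z z' \<in> ?P" if "z \<in> ?P" "z' \<in> ?P" for z z'
    using that by (auto simp: sw_def PiE_iff extensional_def)
  have weight: "?W (sw z z') * ?W (sw z' z) = ?W z * ?W z'" for z z'
    unfolding prod.distrib[symmetric] by (intro prod.cong) (auto simp: sw_def mult.commute)
  have inv: "sw (sw z z') (sw z' z) = z" for z z' by (auto simp: sw_def)
  have double: "product_mean s A w (\<lambda>z. product_mean s A w (\<lambda>z'. K z z'))
      = (\<Sum>(z, z')\<in>?P \<times> ?P. ?W z * ?W z' * K z z')" for K
    by (simp only: product_mean_def sum_distrib_left mult.assoc sum.cartesian_product)
  let ?j = "\<lambda>(z, z'). (sw z z', sw z' z)"
  show ?thesis unfolding double
  proof (rule sum.reindex_bij_witness[of _ ?j ?j], goal_cases)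
    case (5 y)
    show ?case by (cases y) (simp add: weight)
  qed (auto simp only: split_paired_all case_prod_conv mem inv mem_Times_iff fst_conv snd_conv)
qed

text \<open>The true mean is the mean over a ghost sample \<open>z'\<close>, and the maximum of
  means is at most the mean of maxima. Swapping \<open>z\<close> and \<open>z'\<close> where
  \<open>\<sigma> t = - 1\<close> inserts the signs without changing the double mean.\<close>

lemma symmetrization:
  fixes f :: "'x \<Rightarrow> 'a \<Rightarrow> real"
  assumes F: "finite F" "F \<noteq> {}" and A: "finite A" "\<And>a. a \<in> A \<Longrightarrow> 0 \<le> w a" "sum w A = 1"
  shows "product_mean s A w (\<lambda>z. MAX X\<in>F. \<Sum>t<s. (\<Sum>a\<in>A. w a * f X a) - f X (z t))
    \<le> 2 * product_mean s A w (\<lambda>z. rademacher_mean s (\<lambda>\<sigma>. MAX X\<in>F. \<Sum>t<s. \<sigma> t * f X (z t)))"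
proof -
  define E where "E = product_mean s A w"
  define D where "D X z = (\<Sum>t<s. f X (z t))" for X and z :: "nat \<Rightarrow> 'a"
  define G where "G \<sigma> z z' = (MAX X\<in>F. \<Sum>t<s. \<sigma> t * (f X (z' t) - f X (z t)))"
    for \<sigma> :: "nat \<Rightarrow> real" and z z'
  define R where "R \<sigma> z = (MAX X\<in>F. \<Sum>t<s. \<sigma> t * f X (z t))" for \<sigma> :: "nat \<Rightarrow> real" and z
  have Max_leI: "(MAX X\<in>F. h X) \<le> u" if "\<And>X. X \<in> F \<Longrightarrow> h X \<le> u" for h :: "'x \<Rightarrow> real" and u
    using that F by (auto intro!: Max.boundedI)
  have Max_geI: "h X \<le> (MAX X\<in>F. h X)" if "X \<in> F" for h :: "'x \<Rightarrow> real" and X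
    using that F by auto
  have "E (\<lambda>z. MAX X\<in>F. \<Sum>t<s. (\<Sum>a\<in>A. w a * f X a) - f X (z t))
      \<le> E (\<lambda>z. E (\<lambda>z'. G (\<lambda>_. 1) z z'))"
    unfolding E_def
  proof (intro product_mean_mono A Max_leI)
    fix z X assume X: "X \<in> F"
    have "(\<Sum>t<s. (\<Sum>a\<in>A. w a * f X a) - f X (z t))
        = product_mean s A w (\<lambda>z'. \<Sum>t<s. 1 * (f X (z' t) - f X (z t)))"
      using A by (simp add: product_mean_sum product_mean_diff product_mean_coordinate)
    also have "\<dots> \<le> product_mean s A w (\<lambda>z'. G (\<lambda>_. 1) z z')"
      unfolding G_def by (intro product_mean_mono A Max_geI[OF X])
    finally show "(\<Sum>t<s. (\<Sum>a\<in>A. w a * f X a) - f X (z t)) \<le> product_mean s A w (\<lambda>z'. G (\<lambda>_. 1) z z')" .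
  qed
  also have "\<dots> = rademacher_mean s (\<lambda>\<sigma>. E (\<lambda>z. E (\<lambda>z'. G (\<lambda>_. 1) z z')))"
    by simp
  also have "\<dots> = rademacher_mean s (\<lambda>\<sigma>. E (\<lambda>z. E (\<lambda>z'. G \<sigma> z z')))"
  proof (rule product_mean_cong)
    fix \<sigma> assume \<sigma>: "\<sigma> \<in> {..<s} \<rightarrow>\<^sub>E {- 1, 1 :: real}"
    let ?sw = "\<lambda>(z :: nat \<Rightarrow> 'a) z' t. if t \<in> {t. \<sigma> t = - 1} then z' t else z t"
    have "G (\<lambda>_. 1) (?sw z z') (?sw z' z) = G \<sigma> z z'" for z z'
      unfolding G_def using signs_cases[OF \<sigma>]
      by (intro arg_cong[where f = Max] image_cong refl sum.cong) force
    thus "E (\<lambda>z. E (\<lambda>z'. G (\<lambda>_. 1) z z')) = E (\<lambda>z. E (\<lambda>z'. G \<sigma> z z'))"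
      using swapped_product_mean[of s A w "G (\<lambda>_. 1)" "{t. \<sigma> t = - 1}"] by (simp add: E_def)
  qed
  \<comment> \<open>The maximum of a difference splits into one maximum per sample; the minus sign
    moves into the signs, where negation is harmless. The two halves give the factor 2.\<close>
  also have "\<dots> \<le> rademacher_mean s (\<lambda>\<sigma>. E (\<lambda>z. E (\<lambda>z'. R \<sigma> z' + R (\<lambda>t\<in>{..<s}. - \<sigma> t) z)))"
    unfolding E_def
  proof (intro product_mean_mono A)
    fix \<sigma> :: "nat \<Rightarrow> real" and z z' :: "nat \<Rightarrow> 'a"
    show "G \<sigma> z z' \<le> R \<sigma> z' + R (\<lambda>t\<in>{..<s}. - \<sigma> t) z"
      unfolding G_def
    proof (rule Max_leI)
      fix X assume X: "X \<in> F"
      have "(\<Sum>t<s. \<sigma> t * (f X (z' t) - f X (z t)))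
          = (\<Sum>t<s. \<sigma> t * f X (z' t)) + (\<Sum>t<s. (\<lambda>t\<in>{..<s}. - \<sigma> t) t * f X (z t))"
        by (simp add: sum.distrib[symmetric] algebra_simps)
      also have "\<dots> \<le> R \<sigma> z' + R (\<lambda>t\<in>{..<s}. - \<sigma> t) z"
        unfolding R_def by (intro add_mono Max_geI[OF X])
      finally show "(\<Sum>t<s. \<sigma> t * (f X (z' t) - f X (z t))) \<le> R \<sigma> z' + R (\<lambda>t\<in>{..<s}. - \<sigma> t) z" .
    qed
  qed auto
  also have "\<dots> = rademacher_mean s (\<lambda>\<sigma>. E (R \<sigma>)) + rademacher_mean s (\<lambda>\<sigma>. E (R (\<lambda>t\<in>{..<s}. - \<sigma> t)))"
    using A by (simp add: E_def product_mean_add)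
  also have "\<dots> = 2 * rademacher_mean s (\<lambda>\<sigma>. E (R \<sigma>))"
    by (subst rademacher_mean_uminus) simp
  also have "\<dots> = 2 * E (\<lambda>z. rademacher_mean s (\<lambda>\<sigma>. R \<sigma> z))"
    unfolding E_def by (subst product_mean_swap) simp
  finally show ?thesis unfolding E_def R_def .
qed

section \<open>Expected maximum of sums of bounded nonnegative variables\<close>

lemma exp_le_linear:
  fixes x :: real
  assumes "0 \<le> x" "x \<le> 1"
  shows "exp x \<le> 1 + 2 * x"
proof -
  have "exp x \<le> 1 + x + x\<^sup>2" using exp_bound assms by blast
  also have "x\<^sup>2 \<le> x" using assms by (simp add: power2_eq_square mult_left_le)
  finally show ?thesis by simp
qed

text \<open>Division by \<open>R\<close> brings the exponents into \<open>[0, 1]\<close>, where the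
  exponential is at most \<open>1 + 2 * x\<close>; independence turns the mean into an
  \<open>s\<close>-th power.\<close>

lemma exp_product_mean_sum_le:
  fixes \<xi> :: "'a \<Rightarrow> real"
  assumes A: "finite A" "\<And>a. a \<in> A \<Longrightarrow> 0 \<le> w a" "sum w A = 1"
    and R: "0 < R" and \<xi>: "\<And>a. a \<in> A \<Longrightarrow> 0 \<le> \<xi> a \<and> \<xi> a \<le> R" and v: "(\<Sum>a\<in>A. w a * \<xi> a) \<le> v"
  shows "product_mean s A w (\<lambda>z. exp ((\<Sum>t<s. \<xi> (z t)) / R)) \<le> exp (2 * real s * v / R)"
proof -
  have "product_mean s A w (\<lambda>z. exp ((\<Sum>t<s. \<xi> (z t)) / R)) = product_mean s A w (\<lambda>z. \<Prod>t<s. exp (\<xi> (z t) / R))"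
    by (simp add: sum_divide_distrib exp_sum)
  also have "\<dots> = (\<Sum>a\<in>A. w a * exp (\<xi> a / R)) ^ s"
    by (subst product_mean_prod[OF A(1)]) simp
  also have "\<dots> \<le> exp (2 * v / R) ^ s"
  proof (intro power_mono)
    have "(\<Sum>a\<in>A. w a * exp (\<xi> a / R)) \<le> (\<Sum>a\<in>A. w a * (1 + 2 * (\<xi> a / R)))"
      using A(2) \<xi> R by (intro sum_mono mult_left_mono exp_le_linear) auto
    also have "\<dots> = 1 + 2 / R * (\<Sum>a\<in>A. w a * \<xi> a)"
      using A(3) by (simp add: distrib_left sum.distrib sum_distrib_left mult_ac)
    also have "\<dots> \<le> 1 + 2 / R * v" using v R by (intro add_left_mono mult_left_mono) auto
    also have "\<dots> \<le> exp (2 * v / R)" using exp_ge_add_one_self[of "2 * v / R"] by simp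
    finally show "(\<Sum>a\<in>A. w a * exp (\<xi> a / R)) \<le> exp (2 * v / R)" .
  qed (auto intro!: sum_nonneg mult_nonneg_nonneg A)
  also have "\<dots> = exp (2 * real s * v / R)" by (simp add: exp_of_nat_mult[symmetric] mult_ac)
  finally show ?thesis .
qed

text \<open>By \<open>y \<le> c + exp (y - c)\<close> the maximum is bounded by \<open>c\<close>
  plus a sum of exponentials over all \<open>b\<close>, whose means are the preceding exponential
  moments.\<close>

lemma product_mean_Max_le:
  fixes \<xi> :: "nat \<Rightarrow> 'a \<Rightarrow> real"
  assumes A: "finite A" "\<And>a. a \<in> A \<Longrightarrow> 0 \<le> w a" "sum w A = 1" and n: "0 < n" and R: "0 < R"
    and \<xi>: "\<And>b a. b < n \<Longrightarrow> a \<in> A \<Longrightarrow> 0 \<le> \<xi> b a \<and> \<xi> b a \<le> R"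
    and v: "\<And>b. b < n \<Longrightarrow> (\<Sum>a\<in>A. w a * \<xi> b a) \<le> v"
  shows "product_mean s A w (\<lambda>z. MAX b\<in>{..<n}. \<Sum>t<s. \<xi> b (z t)) \<le> R * (1 + ln n) + 2 * real s * v"
proof -
  \<comment> \<open>Chosen so that the bounds on the \<open>n\<close> exponential moments add up to
    \<open>exp c\<close>, which the factor \<open>exp (- c)\<close> cancels.\<close>
  define c where "c = 2 * real s * v / R + ln n"
  have "product_mean s A w (\<lambda>z. MAX b\<in>{..<n}. \<Sum>t<s. \<xi> b (z t))
      \<le> product_mean s A w (\<lambda>z. R * (c + exp (- c) * (\<Sum>b<n. exp ((\<Sum>t<s. \<xi> b (z t)) / R))))"
  proof (intro product_mean_mono A)
    fix z
    have "(MAX b\<in>{..<n}. \<Sum>t<s. \<xi> b (z t)) \<in> (\<lambda>b. \<Sum>t<s. \<xi> b (z t)) ` {..<n}"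
      using n by (intro Max_in) auto
    then obtain b where b: "b < n" "(MAX b\<in>{..<n}. \<Sum>t<s. \<xi> b (z t)) = (\<Sum>t<s. \<xi> b (z t))" by auto
    let ?y = "(\<Sum>t<s. \<xi> b (z t)) / R"
    have "?y \<le> c + exp (?y - c)" using exp_ge_add_one_self[of "?y - c"] by linarith
    also have "exp (?y - c) = exp (- c) * exp ?y" by (simp flip: exp_add)
    also have "exp ?y \<le> (\<Sum>b<n. exp ((\<Sum>t<s. \<xi> b (z t)) / R))"
      using b(1) by (intro member_le_sum) auto
    finally have "?y \<le> c + exp (- c) * (\<Sum>b<n. exp ((\<Sum>t<s. \<xi> b (z t)) / R))" by simp
    thus "(MAX b\<in>{..<n}. \<Sum>t<s. \<xi> b (z t)) \<le> R * (c + exp (- c) * (\<Sum>b<n. exp ((\<Sum>t<s. \<xi> b (z t)) / R)))"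
      unfolding b(2) using R by (simp add: pos_divide_le_eq mult.commute)
  qed
  also have "\<dots> = R * (c + exp (- c) * (\<Sum>b<n. product_mean s A w (\<lambda>z. exp ((\<Sum>t<s. \<xi> b (z t)) / R))))"
    using A by (simp only: product_mean_cmult product_mean_add product_mean_const product_mean_sum)
  also have "\<dots> \<le> R * (c + exp (- c) * (\<Sum>b<n. exp (2 * real s * v / R)))"
    using R \<xi> v by (intro mult_left_mono add_left_mono sum_mono exp_product_mean_sum_le A) auto
  also have "\<dots> = R * (c + 1)" 
  proof -
    have "(\<Sum>b<n. exp (2 * real s * v / R)) = exp c" using n by (simp add: c_def exp_add)
    thus ?thesis by (simp add: exp_minus)
  qed
  also have "\<dots> = R * (1 + ln n) + 2 * real s * v" using R by (simp add: c_def field_simps)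
  finally show ?thesis .
qed

section \<open>Sampling lists\<close>

lemma pmf_replicate_pmf_Cons:
  "pmf (replicate_pmf (Suc s) p) (x # xs) = pmf p x * pmf (replicate_pmf s p) xs"
proof -
  have "replicate_pmf (Suc s) p = map_pmf (\<lambda>(x, xs). x # xs) (pair_pmf p (replicate_pmf s p))"
    by (simp add: pair_pmf_def map_bind_pmf)
  moreover have "inj (\<lambda>(x :: 'a, xs). x # xs)" by (auto simp: inj_on_def)
  ultimately show ?thesis
    using pmf_map_inj'[of "\<lambda>(x, xs). x # xs" "pair_pmf p (replicate_pmf s p)" "(x, xs)"]
    by (simp add: pmf_pair)
qed

lemma pmf_replicate_pmf:
  "length xs = s \<Longrightarrow> pmf (replicate_pmf s p) xs = (\<Prod>t<s. pmf p (xs ! t))"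
proof (induction s arbitrary: xs)
  case (Suc s)
  then obtain y ys where "xs = y # ys" "length ys = s" by (cases xs) auto
  thus ?case using Suc.IH[of ys] by (simp add: pmf_replicate_pmf_Cons prod.lessThan_Suc_shift del: replicate_pmf.simps prod.lessThan_Suc)
qed simp

text \<open>The bridge from the sampling distribution to finite sums: lists of length
  \<open>s\<close> correspond to extensional functions on \<open>{..<s}\<close>.\<close>

lemma expectation_replicate_pmf:
  assumes A: "finite A" "set_pmf p \<subseteq> A"
  shows "measure_pmf.expectation (replicate_pmf s p) g
    = product_mean s A (pmf p) (\<lambda>z. g (map z [0..<s]))"
proof -
  let ?L = "{xs. set xs \<subseteq> A \<and> length xs = s}"
  have "measure_pmf.expectation (replicate_pmf s p) g = (\<Sum>xs\<in>?L. g xs * pmf (replicate_pmf s p) xs)"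
    using A by (intro integral_measure_pmf_real) (auto simp: finite_lists_length_eq set_replicate_pmf)
  also have "\<dots> = (\<Sum>z\<in>{..<s} \<rightarrow>\<^sub>E A. (\<Prod>t<s. pmf p (z t)) * g (map z [0..<s]))"
  proof (rule sum.reindex_bij_witness[of _ "\<lambda>z. map z [0..<s]" "\<lambda>xs. \<lambda>t\<in>{..<s}. xs ! t"])
    fix xs assume xs: "xs \<in> ?L"
    thus "map (\<lambda>t\<in>{..<s}. xs ! t) [0..<s] = xs"
      by (intro nth_equalityI) auto
    with xs show "(\<Prod>t<s. pmf p ((\<lambda>t\<in>{..<s}. xs ! t) t)) * g (map (\<lambda>t\<in>{..<s}. xs ! t) [0..<s])
        = g xs * pmf (replicate_pmf s p) xs"
      by (simp add: pmf_replicate_pmf)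
    show "(\<lambda>t\<in>{..<s}. xs ! t) \<in> {..<s} \<rightarrow>\<^sub>E A" using xs by auto
  next
    fix z assume z: "z \<in> {..<s} \<rightarrow>\<^sub>E A"
    thus "(\<lambda>t\<in>{..<s}. map z [0..<s] ! t) = z" by (auto simp: PiE_iff extensional_def)
    show "map z [0..<s] \<in> ?L" using z by (auto simp: PiE_iff)
  qed
  finally show ?thesis by (simp add: product_mean_def)
qed

section \<open>The weighted trace-norm class\<close>

lemma sum_lessThan_add:
  fixes f :: "nat \<Rightarrow> 'a :: comm_monoid_add"
  shows "(\<Sum>b<n + m. f b) = (\<Sum>i<n. f i) + (\<Sum>j<m. f (n + j))"
  by (induction m) (simp_all add: add.assoc)

text \<open>The \<open>b\<close>-th diagonal entry of the square of the symmetric dilation of the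
  sampled cell \<open>a\<close>. That square is diagonal, so summing over the draws gives the row
  variances (\<open>b < n\<close>) and column variances (\<open>b \<ge> n\<close>), and the largest
  sum is the operator norm.\<close>

definition cell_weight :: "nat \<Rightarrow> (nat \<Rightarrow> real) \<Rightarrow> (nat \<Rightarrow> real) \<Rightarrow> nat \<Rightarrow> nat \<times> nat \<Rightarrow> real" where
  "cell_weight n qr qc b a =
     (if b = fst a \<or> b = n + snd a then 1 / (qr (fst a) * qc (snd a)) else 0)"

text \<open>The matrix with entry $(i, j)$ scaled by the weights is one off-diagonal block of the symmetric matrix
  of size $n + m$ that carries column $j$ at index $n + j$.\<close>

lemma weighted_class_rademacher:
  assumes F: "finite F" "F \<noteq> {}" "F \<subseteq> weighted_class n m r qr qc" and l: "0 \<le> l"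
    and qr: "\<And>i. i < n \<Longrightarrow> 0 < qr i" and qc: "\<And>j. j < m \<Longrightarrow> 0 < qc j"
    and z: "\<And>t. t < s \<Longrightarrow> z t \<in> {..<n} \<times> {..<m}" and s: "0 < s"
    and p: "0 < p" "real (n + m) \<le> exp (real p)"
  shows "rademacher_mean s (\<lambda>\<sigma>. MAX X\<in>F. \<Sum>t<s. \<sigma> t * (l * X $$ z t))
    \<le> l * sqrt r * (2 * sqrt (4 * exp 1 * real p * (MAX b\<in>{..<n + m}. \<Sum>t<s. cell_weight n qr qc b (z t))))"
proof -
  define N where "N = n + m"
  define f where "f t = fst (z t)" for t
  define g where "g t = snd (z t)" for t
  define \<omega> where "\<omega> t = 1 / (qr (f t) * qc (g t))" for t
  have f: "f t < n" and g: "g t < m" if "t < s" for t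
    using z[OF that] by (auto simp: f_def g_def mem_Times_iff)
  have \<omega>: "0 < \<omega> t" if "t < s" for t
    using f[OF that] g[OF that] qr qc by (auto simp: \<omega>_def)
  define M where "M = (MAX b\<in>{..<N}. \<Sum>t<s. cell_weight n qr qc b (z t))"
  have M_ge: "(\<Sum>t<s. cell_weight n qr qc b (z t)) \<le> M" if "b < N" for b
    unfolding M_def using that by (intro Max_ge) auto
  have cw: "cell_weight n qr qc b (z t) = (if b = f t \<or> b = n + g t then \<omega> t else 0)" for b t
    by (simp add: cell_weight_def f_def g_def \<omega>_def)
  have N: "0 < N" "f 0 < N" using f[OF s] by (auto simp: N_def)
  \<comment> \<open>The row of the first draw already carries positive weight; the operator bound
    needs \<open>M\<close> strictly positive.\<close>
  have "0 < (\<Sum>t<s. cell_weight n qr qc (f 0) (z t))"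
    using s \<omega> by (intro sum_pos2[of _ 0]) (auto simp: cw less_imp_le)
  hence M: "0 < M" using M_ge[OF N(2)] by linarith
  define H where "H t i j = sqrt (\<omega> t) *
    (if i = f t \<and> j = n + g t \<or> i = n + g t \<and> j = f t then 1 else 0)" for t i j
  have H_sym: "H t i j = H t j i" for t i j by (auto simp: H_def)
  have "(\<Sum>t<s. \<Sum>i<N. (\<Sum>j<N. H t i j * x j)\<^sup>2) \<le> M * (\<Sum>i<N. (x i)\<^sup>2)" for x
  proof -
    have "(\<Sum>i<N. (\<Sum>j<N. H t i j * x j)\<^sup>2) = (\<Sum>b<N. cell_weight n qr qc b (z t) * (x b)\<^sup>2)" if t: "t < s" for t
    proof -
      have ft: "f t < N" "n + g t < N" "f t \<noteq> n + g t" using f[OF t] g[OF t] by (auto simp: N_def)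
      have "(\<Sum>j<N. H t i j * x j)\<^sup>2 = (if i = f t then \<omega> t * (x (n + g t))\<^sup>2 else 0)
          + (if i = n + g t then \<omega> t * (x (f t))\<^sup>2 else 0)" if "i < N" for i
      proof -
        have "(\<Sum>j<N. H t i j * x j) = (\<Sum>j<N. if j = n + g t then (if i = f t then sqrt (\<omega> t) * x j else 0) else 0)
            + (\<Sum>j<N. if j = f t then (if i = n + g t then sqrt (\<omega> t) * x j else 0) else 0)"
          unfolding sum.distrib[symmetric] using ft by (intro sum.cong) (auto simp: H_def)
        also have "\<dots> = (if i = f t then sqrt (\<omega> t) * x (n + g t) else 0) + (if i = n + g t then sqrt (\<omega> t) * x (f t) else 0)"
          using ft by simp
        finally show ?thesis using ft \<omega>[OF t] by (auto simp: power_mult_distrib)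
      qed
      hence "(\<Sum>i<N. (\<Sum>j<N. H t i j * x j)\<^sup>2) = \<omega> t * (x (n + g t))\<^sup>2 + \<omega> t * (x (f t))\<^sup>2"
        using ft by (simp add: sum.distrib)
      also have "\<dots> = (\<Sum>b<N. (if b = n + g t then \<omega> t * (x b)\<^sup>2 else 0) + (if b = f t then \<omega> t * (x b)\<^sup>2 else 0))"
        using ft by (simp add: sum.distrib)
      also have "\<dots> = (\<Sum>b<N. cell_weight n qr qc b (z t) * (x b)\<^sup>2)"
        using ft by (intro sum.cong) (auto simp: cw)
      finally show ?thesis .
    qed
    hence "(\<Sum>t<s. \<Sum>i<N. (\<Sum>j<N. H t i j * x j)\<^sup>2) = (\<Sum>t<s. \<Sum>b<N. cell_weight n qr qc b (z t) * (x b)\<^sup>2)"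
      by simp
    also have "\<dots> = (\<Sum>b<N. (\<Sum>t<s. cell_weight n qr qc b (z t)) * (x b)\<^sup>2)"
      unfolding sum_distrib_right by (rule sum.swap)
    also have "\<dots> \<le> (\<Sum>b<N. M * (x b)\<^sup>2)"
      using M_ge by (intro sum_mono mult_right_mono) auto
    finally show ?thesis by (simp add: sum_distrib_left)
  qed
  then obtain c where c: "\<And>\<sigma>. 0 \<le> c \<sigma>"
    "\<And>\<sigma> x. (\<Sum>i<N. (\<Sum>j<N. (\<Sum>t<s. \<sigma> t * H t i j) * x j)\<^sup>2) \<le> (c \<sigma>)\<^sup>2 * (\<Sum>i<N. (x i)\<^sup>2)"
    "rademacher_mean s c \<le> 2 * sqrt (4 * exp 1 * real p * M)"
    using rademacher_operator_bound[of s N H M p] H_sym M N(1) p by (auto simp: N_def)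
  have class_le: "(\<Sum>t<s. \<sigma> t * X $$ z t) \<le> c \<sigma> * sqrt r" if X: "X \<in> F" for X \<sigma>
  proof -
    define C where "C i j = (\<Sum>t<s. \<sigma> t * (if z t = (i, j) then 1 else 0))" for i j
    have S: "(\<Sum>t<s. \<sigma> t * H t i (n + j)) = C i j / sqrt (qr i * qc j)" if "i < n" "j < m" for i j
      unfolding C_def sum_divide_distrib
    proof (intro sum.cong refl)
      fix t assume "t \<in> {..<s}"
      show "\<sigma> t * H t i (n + j) = \<sigma> t * (if z t = (i, j) then 1 else 0) / sqrt (qr i * qc j)"
        using that by (auto simp: H_def f_def g_def \<omega>_def real_sqrt_divide prod_eq_iff)
    qed
    have "(\<Sum>i<n. (\<Sum>j<m. C i j / sqrt (qr i * qc j) * v j)\<^sup>2) \<le> (c \<sigma>)\<^sup>2 * (\<Sum>j<m. (v j)\<^sup>2)" for v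
    proof -
      \<comment> \<open>\<open>x\<close> places \<open>v\<close> on the column indices, so the first
        \<open>n\<close> entries of the image are the off-diagonal block applied to
        \<open>v\<close>; the other entries only add to the norm.\<close>
      define x where "x b = (if b < n then 0 else v (b - n))" for b
      have "(\<Sum>i<n. (\<Sum>j<m. C i j / sqrt (qr i * qc j) * v j)\<^sup>2)
          = (\<Sum>i<n. (\<Sum>b<N. (\<Sum>t<s. \<sigma> t * H t i b) * x b)\<^sup>2)"
        unfolding N_def sum_lessThan_add by (simp add: x_def S)
      also have "\<dots> \<le> (\<Sum>i<N. (\<Sum>b<N. (\<Sum>t<s. \<sigma> t * H t i b) * x b)\<^sup>2)"
        by (intro sum_mono2) (auto simp: N_def)
      also have "\<dots> \<le> (c \<sigma>)\<^sup>2 * (\<Sum>b<N. (x b)\<^sup>2)" by (rule c(2))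
      also have "(\<Sum>b<N. (x b)\<^sup>2) = (\<Sum>j<m. (v j)\<^sup>2)"
        unfolding N_def sum_lessThan_add by (simp add: x_def)
      finally show ?thesis .
    qed
    moreover have "(\<Sum>i<n. \<Sum>j<m. X $$ (i, j) * C i j) = (\<Sum>t<s. \<sigma> t * X $$ z t)"
    proof -
      have "(\<Sum>i<n. \<Sum>j<m. X $$ (i, j) * C i j)
          = (\<Sum>a\<in>{..<n} \<times> {..<m}. \<Sum>t<s. if a = z t then \<sigma> t * X $$ z t else 0)"
        unfolding C_def sum_distrib_left by (subst sum.cartesian_product) (auto intro!: sum.cong)
      also have "\<dots> = (\<Sum>t<s. \<Sum>a\<in>{..<n} \<times> {..<m}. if a = z t then \<sigma> t * X $$ z t else 0)"
        by (rule sum.swap)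
      also have "\<dots> = (\<Sum>t<s. \<sigma> t * X $$ z t)"
      proof (intro sum.cong refl)
        fix t assume "t \<in> {..<s}"
        hence "z t \<in> {..<n} \<times> {..<m}" using z by simp
        thus "(\<Sum>a\<in>{..<n} \<times> {..<m}. if a = z t then \<sigma> t * X $$ z t else 0) = \<sigma> t * X $$ z t"
          by (subst sum.delta) auto
      qed
      finally show ?thesis .
    qed
    ultimately show ?thesis
      using weighted_class_duality[of X n m r qr qc "c \<sigma>" C] X F(3) c(1) qr qc by auto
  qed
  have "(\<Sum>t<s. \<sigma> t * (l * X $$ z t)) \<le> l * sqrt r * c \<sigma>" if "X \<in> F" for X \<sigma>
    using mult_left_mono[OF class_le[OF that, of \<sigma>] l] by (simp add: sum_distrib_left mult_ac)
  hence "rademacher_mean s (\<lambda>\<sigma>. MAX X\<in>F. \<Sum>t<s. \<sigma> t * (l * X $$ z t)) \<le> rademacher_mean s (\<lambda>\<sigma>. l * sqrt r * c \<sigma>)"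
    using F by (intro product_mean_mono Max.boundedI) auto
  also have "\<dots> = l * sqrt r * rademacher_mean s c" by (rule product_mean_cmult)
  also have "\<dots> \<le> l * sqrt r * (2 * sqrt (4 * exp 1 * real p * M))"
  proof (rule mult_left_mono[OF c(3)])
    obtain X where X: "X \<in> F" using F by auto
    \<comment> \<open>\<open>sqrt\<close> is negative on negative reals, but a nonempty class rules
      that out: pair a member with the zero matrix.\<close>
    have "0 \<le> sqrt r"
    proof -
      have "(\<Sum>i<n. \<Sum>j<m. X $$ (i, j) * 0) \<le> 1 * sqrt r"
        using X F(3) qr qc by (intro weighted_class_duality[of X n m r qr qc]) (auto intro!: sum_nonneg)
      thus ?thesis by simp
    qed
    thus "0 \<le> l * sqrt r" using l by simp
  qed
  finally show ?thesis by (simp add: M_def N_def)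
qed

section \<open>Consequences of smoothing the marginals\<close>

lemma row_marginal_nonneg: "0 \<le> row_marginal m p i"
  by (simp add: row_marginal_def sum_nonneg)

lemma col_marginal_nonneg: "0 \<le> col_marginal n p j"
  by (simp add: col_marginal_def sum_nonneg)

text \<open>The two halves of the smoothing at work: the uniform part bounds the inverse weight, the
  marginal part bounds the ratio of marginal to weight by 2.\<close>

lemma smoothed_row_ge: "1 / (2 * real n) \<le> smoothed_row n m p i" "row_marginal m p i \<le> 2 * smoothed_row n m p i"
  using row_marginal_nonneg[of m p i] by (auto simp: smoothed_row_def field_simps)

lemma smoothed_col_ge: "1 / (2 * real m) \<le> smoothed_col n m p j" "col_marginal n p j \<le> 2 * smoothed_col n m p j"
  using col_marginal_nonneg[of n p j] by (auto simp: smoothed_col_def field_simps)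

lemma smoothed_row_pos: "0 < n \<Longrightarrow> 0 < smoothed_row n m p i"
  by (rule less_le_trans[OF _ smoothed_row_ge(1)]) simp

lemma smoothed_col_pos: "0 < m \<Longrightarrow> 0 < smoothed_col n m p j"
  by (rule less_le_trans[OF _ smoothed_col_ge(1)]) simp

text \<open>Schur test for the matrix with entries $p(i, j) / \sqrt{\tilde p^r(i) \tilde p^c(j)}$.\<close>

lemma smoothed_class_mean_abs_le:
  assumes X: "X \<in> smoothed_class n m r p" and n: "0 < n" and m: "0 < m"
  shows "(\<Sum>i<n. \<Sum>j<m. pmf p (i, j) * \<bar>X $$ (i, j)\<bar>) \<le> 2 * sqrt r"
proof -
  let ?qr = "smoothed_row n m p" and ?qc = "smoothed_col n m p"
  have qr: "0 < ?qr i" and qc: "0 < ?qc j" for i j using smoothed_row_pos smoothed_col_pos n m by auto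
  define C where "C i j = pmf p (i, j) * sgn (X $$ (i, j))" for i j
  have "(\<Sum>i<n. (\<Sum>j<m. C i j / sqrt (?qr i * ?qc j) * v j)\<^sup>2) \<le> 2\<^sup>2 * (\<Sum>j<m. (v j)\<^sup>2)" for v
  proof -
    have "(\<Sum>i<n. (\<Sum>j<m. C i j / sqrt (?qr i * ?qc j) * v j)\<^sup>2)
        \<le> (\<Sum>i<n. 2 * (\<Sum>j<m. pmf p (i, j) / ?qc j * (v j)\<^sup>2))"
    proof (intro sum_mono)
      fix i
      \<comment> \<open>The entry is split as \<open>sqrt (p / q^r) * sqrt (p / q^c)\<close>. After
        Cauchy-Schwarz the first factor sums over \<open>j\<close> to a row ratio and the second,
        summed over \<open>i\<close>, to a column ratio, both at most 2.\<close>
      let ?a = "\<lambda>j. sqrt (pmf p (i, j) / ?qr i)"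
      let ?b = "\<lambda>j. sgn (X $$ (i, j)) * sqrt (pmf p (i, j) / ?qc j) * v j"
      have "(\<Sum>j<m. C i j / sqrt (?qr i * ?qc j) * v j)\<^sup>2 = (\<Sum>j<m. ?a j * ?b j)\<^sup>2"
      proof (rule arg_cong[where f = "\<lambda>x. x\<^sup>2"], intro sum.cong refl)
        fix j
        have "?a j * ?b j = sgn (X $$ (i, j)) * v j * ((sqrt (pmf p (i, j)) * sqrt (pmf p (i, j))) / (sqrt (?qr i) * sqrt (?qc j)))"
          by (simp add: real_sqrt_divide)
        thus "C i j / sqrt (?qr i * ?qc j) * v j = ?a j * ?b j"
          by (simp add: C_def real_sqrt_mult)
      qed
      also have "\<dots> \<le> (\<Sum>j<m. (?a j)\<^sup>2) * (\<Sum>j<m. (?b j)\<^sup>2)" by (rule Cauchy_Schwarz_ineq_sum)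
      also have "\<dots> \<le> 2 * (\<Sum>j<m. pmf p (i, j) / ?qc j * (v j)\<^sup>2)"
      proof (intro mult_mono sum_mono)
        have "(\<Sum>j<m. (?a j)\<^sup>2) = row_marginal m p i / ?qr i"
          using qr[of i] by (simp add: row_marginal_def sum_divide_distrib)
        also have "\<dots> \<le> 2" using smoothed_row_ge(2)[of m p i n] qr[of i] by (simp add: pos_divide_le_eq)
        finally show "(\<Sum>j<m. (?a j)\<^sup>2) \<le> 2" .
        fix j
        show "(?b j)\<^sup>2 \<le> pmf p (i, j) / ?qc j * (v j)\<^sup>2"
          using qc[of j] by (auto simp: power_mult_distrib sgn_if)
      qed (auto intro!: sum_nonneg)
      finally show "(\<Sum>j<m. C i j / sqrt (?qr i * ?qc j) * v j)\<^sup>2 \<le> 2 * (\<Sum>j<m. pmf p (i, j) / ?qc j * (v j)\<^sup>2)" .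
    qed
    also have "\<dots> = 2 * (\<Sum>j<m. \<Sum>i<n. pmf p (i, j) / ?qc j * (v j)\<^sup>2)"
      unfolding sum_distrib_left[symmetric] by (subst sum.swap) simp
    also have "\<dots> = 2 * (\<Sum>j<m. col_marginal n p j / ?qc j * (v j)\<^sup>2)"
      by (simp add: col_marginal_def sum_divide_distrib sum_distrib_right)
    also have "\<dots> \<le> 2 * (\<Sum>j<m. 2 * (v j)\<^sup>2)"
      using smoothed_col_ge(2)[of n p _ m] qc
      by (intro mult_left_mono sum_mono mult_right_mono) (auto simp: pos_divide_le_eq)
    finally show ?thesis by (simp add: sum_distrib_left)
  qed
  hence "(\<Sum>i<n. \<Sum>j<m. X $$ (i, j) * C i j) \<le> 2 * sqrt r"
    using X qr qc unfolding smoothed_class_def by (intro weighted_class_duality) auto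
  moreover have "X $$ (i, j) * C i j = pmf p (i, j) * \<bar>X $$ (i, j)\<bar>" for i j
    by (simp add: C_def abs_sgn mult_ac)
  ultimately show ?thesis by simp
qed

lemma sum_set_pmf_eq_grid:
  fixes p :: "(nat \<times> nat) pmf"
  assumes "set_pmf p \<subseteq> {..<n} \<times> {..<m}"
  shows "(\<Sum>a\<in>set_pmf p. pmf p a * h a) = (\<Sum>i<n. \<Sum>j<m. pmf p (i, j) * h (i, j))"
proof -
  have "(\<Sum>a\<in>set_pmf p. pmf p a * h a) = (\<Sum>a\<in>{..<n} \<times> {..<m}. pmf p a * h a)"
    using assms by (intro sum.mono_neutral_left) (auto simp: set_pmf_iff)
  thus ?thesis by (simp add: sum.cartesian_product)
qed

text \<open>Pointwise, both inverse weights are bounded by the uniform part. In the mean over a row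
  or column, the marginal cancels one weight up to a factor 2 and only the other pays, giving
  \<open>4 * m\<close> for rows and \<open>4 * n\<close> for columns.\<close>

lemma cell_weight_bounds:
  fixes p :: "(nat \<times> nat) pmf"
  assumes m: "0 < m" "m \<le> n" and p: "set_pmf p \<subseteq> {..<n} \<times> {..<m}"
  defines "\<xi> \<equiv> cell_weight n (smoothed_row n m p) (smoothed_col n m p)"
  shows "0 \<le> \<xi> b a" "\<xi> b a \<le> 4 * real n * real m"
    "b < n + m \<Longrightarrow> (\<Sum>a\<in>set_pmf p. pmf p a * \<xi> b a) \<le> 4 * real n"
proof -
  let ?qr = "smoothed_row n m p" and ?qc = "smoothed_col n m p"
  have n: "0 < n" using m by simp
  have qr: "0 < ?qr i" and qc: "0 < ?qc j" for i j using smoothed_row_pos smoothed_col_pos n m by auto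
  have inv_qr: "1 / ?qr i \<le> 2 * real n" for i
    using smoothed_row_ge(1)[of n m p i] qr[of i] n by (simp add: field_simps)
  have inv_qc: "1 / ?qc j \<le> 2 * real m" for j
    using smoothed_col_ge(1)[of m n p j] qc[of j] m by (simp add: field_simps)
  have prod_eq: "1 / (?qr i * ?qc j) = 1 / ?qr i * (1 / ?qc j)" for i j by simp
  show "0 \<le> \<xi> b a" using qr qc by (auto simp: \<xi>_def cell_weight_def less_imp_le)
  have "1 / (?qr i * ?qc j) \<le> 2 * real n * (2 * real m)" for i j
    unfolding prod_eq using inv_qr inv_qc qr[of i] qc[of j] by (intro mult_mono) auto
  thus "\<xi> b a \<le> 4 * real n * real m" by (auto simp: \<xi>_def cell_weight_def mult_ac)
  assume b: "b < n + m"
  show "(\<Sum>a\<in>set_pmf p. pmf p a * \<xi> b a) \<le> 4 * real n"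
  proof (cases "b < n")
    case True
    have "(\<Sum>a\<in>set_pmf p. pmf p a * \<xi> b a)
        = (\<Sum>i<n. if i = b then \<Sum>j<m. pmf p (b, j) * (1 / (?qr b * ?qc j)) else 0)"
      unfolding sum_set_pmf_eq_grid[OF p] \<xi>_def using True
      by (intro sum.cong refl) (auto simp: cell_weight_def)
    also have "\<dots> = (\<Sum>j<m. pmf p (b, j) * (1 / (?qr b * ?qc j)))" using True by simp
    also have "\<dots> \<le> (\<Sum>j<m. pmf p (b, j) * (1 / ?qr b * (2 * real m)))"
      unfolding prod_eq using inv_qc qr[of b] by (intro sum_mono mult_left_mono) auto
    also have "\<dots> = 2 * real m * (row_marginal m p b / ?qr b)"
      by (simp add: row_marginal_def sum_divide_distrib sum_distrib_left mult_ac)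
    also have "\<dots> \<le> 2 * real m * 2"
      using smoothed_row_ge(2)[of m p b n] qr[of b] by (intro mult_left_mono) (auto simp: pos_divide_le_eq)
    also have "\<dots> \<le> 4 * real n" using m by simp
    finally show ?thesis .
  next
    case False
    then obtain k where k: "b = n + k" "k < m" using b by (metis add_less_cancel_left le_iff_add not_less)
    have "(\<Sum>a\<in>set_pmf p. pmf p a * \<xi> b a)
        = (\<Sum>i<n. \<Sum>j<m. if j = k then pmf p (i, k) * (1 / (?qr i * ?qc k)) else 0)"
      unfolding sum_set_pmf_eq_grid[OF p] \<xi>_def using k
      by (intro sum.cong refl) (auto simp: cell_weight_def)
    also have "\<dots> = (\<Sum>i<n. pmf p (i, k) * (1 / (?qr i * ?qc k)))" using k by simp
    also have "\<dots> \<le> (\<Sum>i<n. pmf p (i, k) * (2 * real n * (1 / ?qc k)))"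
      unfolding prod_eq using inv_qr qc[of k] by (intro sum_mono mult_left_mono mult_right_mono) auto
    also have "\<dots> = 2 * real n * (col_marginal n p k / ?qc k)"
      by (simp add: col_marginal_def sum_divide_distrib sum_distrib_left mult_ac)
    also have "\<dots> \<le> 2 * real n * 2"
      using smoothed_col_ge(2)[of n p k m] qc[of k] by (intro mult_left_mono) (auto simp: pos_divide_le_eq)
    finally show ?thesis by simp
  qed
qed

section \<open>Excess loss\<close>

lemma expected_loss_eq_sum:
  assumes "set_pmf p \<subseteq> {..<n} \<times> {..<m}"
  shows "expected_loss n m ell Y p X = (\<Sum>a\<in>set_pmf p. pmf p a * ell (X $$ a) (Y $$ a))"
  by (simp add: expected_loss_def sum_set_pmf_eq_grid[OF assms])

lemma empirical_loss_map:
  "empirical_loss ell Y (map z [0..<s]) X = (\<Sum>t<s. ell (X $$ z t) (Y $$ z t)) / real s"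
  by (simp add: empirical_loss_def)

section \<open>Jensen's inequality and numerical constants\<close>

lemma sqrt_le_tangent:
  assumes "0 < b" "0 \<le> y"
  shows "sqrt y \<le> sqrt b / 2 + y / (2 * sqrt b)"
proof -
  have "0 \<le> (sqrt b - sqrt y)\<^sup>2" by simp
  hence "2 * (sqrt b * sqrt y) \<le> b + y" using assms by (simp add: power2_diff)
  thus ?thesis using assms by (simp add: field_simps)
qed

text \<open>Jensen's inequality from the tangent of the square root at \<open>b\<close>. Using a
  positive upper bound instead of the mean itself avoids a special case for mean zero.\<close>

lemma product_mean_sqrt_le:
  assumes A: "finite A" "\<And>a. a \<in> A \<Longrightarrow> 0 \<le> w a" "sum w A = 1" and b: "0 < b"
    and f: "\<And>z. z \<in> {..<s} \<rightarrow>\<^sub>E A \<Longrightarrow> 0 \<le> f z" "product_mean s A w f \<le> b"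
  shows "product_mean s A w (\<lambda>z. sqrt (f z)) \<le> sqrt b"
proof -
  have "product_mean s A w (\<lambda>z. sqrt (f z)) \<le> product_mean s A w (\<lambda>z. sqrt b / 2 + 1 / (2 * sqrt b) * f z)"
    using sqrt_le_tangent[OF b f(1)] by (intro product_mean_mono A) auto
  also have "\<dots> = sqrt b / 2 + 1 / (2 * sqrt b) * product_mean s A w f"
    using A by (simp only: product_mean_add product_mean_cmult product_mean_const)
  also have "\<dots> \<le> sqrt b / 2 + 1 / (2 * sqrt b) * b"
    using b f(2) by (intro add_left_mono mult_left_mono) auto
  also have "\<dots> = sqrt b" using b by (simp add: real_div_sqrt field_simps)
  finally show ?thesis .
qed

text \<open>\<open>B\<close> bounds the expected maximal row or column variance, and \<open>k\<close> is the moment exponent.\<close>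

lemma sample_size_arithmetic:
  fixes n m s :: nat
  assumes m: "0 < m" "m \<le> n" and n: "2 \<le> n" and s: "real n * ln (real n) \<le> real s"
  defines "B \<equiv> 4 * real n * real m * (1 + ln (real (n + m))) + 2 * real s * (4 * real n)"
    and "k \<equiv> nat \<lceil>ln (real (n + m))\<rceil>"
  shows "0 < k" "real (n + m) \<le> exp (real k)" "0 < B"
    "4 * exp 1 * real k * B \<le> 1156 * (real n * real s * ln (real n))"
proof -
  have ln2: "1 \<le> 2 * ln (real n)"
  proof -
    have "2 / 3 \<le> ln (2 :: real)" by (rule ln2_ge_two_thirds)
    also have "\<dots> \<le> ln (real n)" using n by (subst ln_le_cancel_iff) auto
    finally show ?thesis by simp
  qed
  have "ln (real (n + m)) \<le> ln (real n ^ 2)"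
  proof (subst ln_le_cancel_iff)
    have "real (n + m) \<le> 2 * real n" using m by simp
    also have "\<dots> \<le> real n * real n" using n by (intro mult_right_mono) auto
    finally show "real (n + m) \<le> real n ^ 2" by (simp add: power2_eq_square)
  qed (use n in auto)
  hence lnN: "ln (real (n + m)) \<le> 2 * ln (real n)" using n by (simp add: ln_realpow)
  have lnN_pos: "0 < ln (real (n + m))" using n m by simp
  show "0 < k" using lnN_pos by (simp add: k_def)
  have k_ge: "ln (real (n + m)) \<le> real k" unfolding k_def by (rule real_nat_ceiling_ge)
  have "real (n + m) = exp (ln (real (n + m)))" using n by simp
  also have "\<dots> \<le> exp (real k)" using k_ge by simp
  finally show "real (n + m) \<le> exp (real k)" .
  have k_le: "real k \<le> 4 * ln (real n)"
  proof -
    have "real k \<le> ln (real (n + m)) + 1" unfolding k_def using lnN_pos by linarith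
    thus ?thesis using lnN ln2 by linarith
  qed
  have "0 < real n * ln (real n)" using n ln2 by (intro mult_pos_pos) auto
  hence s_pos: "0 < real s" using s by linarith
  show "0 < B" unfolding B_def using m n lnN_pos s_pos
    by (intro add_nonneg_pos mult_nonneg_nonneg) auto
  \<comment> \<open>Absorbs the worst-case term of \<open>B\<close>: it contributes at most
    \<open>16 * n * s\<close> beside the \<open>8 * n * s\<close> of the mean term.\<close>
  have "real m * (1 + ln (real (n + m))) \<le> real n * (4 * ln (real n))"
    using m lnN ln2 lnN_pos by (intro mult_mono) auto
  also have "\<dots> \<le> 4 * real s" using s by simp
  finally have "4 * real n * (real m * (1 + ln (real (n + m)))) \<le> 4 * real n * (4 * real s)"
    by (intro mult_left_mono) auto
  hence B_le: "B \<le> 24 * (real n * real s)" by (simp add: B_def mult_ac)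
  \<comment> \<open>With \<open>exp 1 \<le> 3\<close> the constant is
    \<open>4 * 3 * 4 * 24 = 1152\<close>, rounded up to the square \<open>34^2\<close>.\<close>
  have "4 * exp 1 * real k * B \<le> 4 * 3 * (4 * ln (real n)) * (24 * (real n * real s))"
    using k_le B_le \<open>0 < B\<close> exp_le ln2 by (intro mult_mono) auto
  also have "\<dots> \<le> 1156 * (real n * real s * ln (real n))"
    using ln2 by (simp add: mult_ac)
  finally show "4 * exp 1 * real k * B \<le> 1156 * (real n * real s * ln (real n))" .
qed

lemma generalization_gap:
  fixes p :: "(nat \<times> nat) pmf"
  assumes m: "0 < m" "m \<le> n" and n: "2 \<le> n" and s: "0 < s" "real n * ln (real n) \<le> real s"
    and p: "set_pmf p \<subseteq> {..<n} \<times> {..<m}" and ell: "lipschitz_loss l ell" and l: "0 \<le> l"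
    and F: "finite F" "F \<noteq> {}" "F \<subseteq> smoothed_class n m r p"
  shows "product_mean s (set_pmf p) (pmf p) (\<lambda>z. MAX X\<in>F. \<Sum>t<s.
        expected_loss n m ell Y p X - ell (X $$ z t) (Y $$ z t))
    \<le> 136 * (l * sqrt r * sqrt (real n * real s * ln (real n)))"
proof -
  let ?A = "set_pmf p" and ?E = "product_mean s (set_pmf p) (pmf p)"
  let ?qr = "smoothed_row n m p" and ?qc = "smoothed_col n m p"
  define k where "k = nat \<lceil>ln (real (n + m))\<rceil>"
  define B where "B = 4 * real n * real m * (1 + ln (real (n + m))) + 2 * real s * (4 * real n)"
  note arith = sample_size_arithmetic[OF m n s(2), folded k_def B_def]
  define M where "M z = (MAX b\<in>{..<n + m}. \<Sum>t<s. cell_weight n ?qr ?qc b (z t))" for z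
  have A: "finite ?A" using p by (rule finite_subset) auto
  have A1: "sum (pmf p) ?A = 1" using A by (simp add: sum_pmf_eq_1)
  have w: "0 \<le> pmf p a" for a by simp
  have n0: "0 < n" using n by simp
  note \<xi> = cell_weight_bounds[OF m p]
  have EM: "?E M \<le> B"
    unfolding M_def B_def
    by (rule product_mean_Max_le[OF A w A1]) (use \<xi> m n in auto)
  have M_nonneg: "0 \<le> M z" for z
    unfolding M_def
    by (rule order_trans[OF _ Max_ge[of _ "\<Sum>t<s. cell_weight n ?qr ?qc 0 (z t)"]])
      (use n in \<open>auto intro!: sum_nonneg \<xi>(1)\<close>)
  have "?E (\<lambda>z. MAX X\<in>F. \<Sum>t<s. expected_loss n m ell Y p X - ell (X $$ z t) (Y $$ z t))
      \<le> 2 * ?E (\<lambda>z. rademacher_mean s (\<lambda>\<sigma>. MAX X\<in>F. \<Sum>t<s. \<sigma> t * ell (X $$ z t) (Y $$ z t)))"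
    unfolding expected_loss_eq_sum[OF p]
    by (rule symmetrization[OF F(1,2) A w A1, where f = "\<lambda>X a. ell (X $$ a) (Y $$ a)"])
  also have "\<dots> \<le> 2 * ?E (\<lambda>z. 2 * (l * sqrt r) * sqrt (4 * exp 1 * real k * M z))"
  proof (intro mult_left_mono product_mean_mono w)
    fix z assume z: "z \<in> {..<s} \<rightarrow>\<^sub>E ?A"
    have zt: "z t \<in> {..<n} \<times> {..<m}" if "t < s" for t using z p that by blast
    have "rademacher_mean s (\<lambda>\<sigma>. MAX X\<in>F. \<Sum>t<s. \<sigma> t * ell (X $$ z t) (Y $$ z t))
        \<le> rademacher_mean s (\<lambda>\<sigma>. MAX X\<in>F. \<Sum>t<s. \<sigma> t * (l * X $$ z t))"
    proof (rule rademacher_contraction[OF F(1,2)])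
      fix X Z t
      show "\<bar>ell (X $$ z t) (Y $$ z t) - ell (Z $$ z t) (Y $$ z t)\<bar> \<le> \<bar>l * X $$ z t - l * Z $$ z t\<bar>"
        using ell l by (simp add: lipschitz_loss_def abs_mult flip: right_diff_distrib)
    qed
    also have "\<dots> \<le> l * sqrt r * (2 * sqrt (4 * exp 1 * real k * M z))"
      unfolding M_def using F(3) zt s(1) arith(1,2) smoothed_row_pos[OF n0] smoothed_col_pos[OF m(1)]
      by (intro weighted_class_rademacher[OF F(1,2) _ l]) (auto simp: smoothed_class_def)
    finally show "rademacher_mean s (\<lambda>\<sigma>. MAX X\<in>F. \<Sum>t<s. \<sigma> t * ell (X $$ z t) (Y $$ z t))
        \<le> 2 * (l * sqrt r) * sqrt (4 * exp 1 * real k * M z)" by (simp add: mult_ac)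
  qed simp
  also have "\<dots> = 4 * (l * sqrt r) * ?E (\<lambda>z. sqrt (4 * exp 1 * real k * M z))"
    by (simp only: product_mean_cmult)
  also have "\<dots> \<le> 4 * (l * sqrt r) * sqrt (1156 * (real n * real s * ln (real n)))"
  proof (rule mult_left_mono)
    have "?E (\<lambda>z. sqrt (4 * exp 1 * real k * M z)) \<le> sqrt (4 * exp 1 * real k * B)"
    proof (rule product_mean_sqrt_le[OF A w A1])
      show "0 < 4 * exp 1 * real k * B" using arith by simp
      show "0 \<le> 4 * exp 1 * real k * M z" for z using M_nonneg by simp
      show "?E (\<lambda>z. 4 * exp 1 * real k * M z) \<le> 4 * exp 1 * real k * B"
        unfolding product_mean_cmult using EM by (intro mult_left_mono) auto
    qed
    also have "\<dots> \<le> sqrt (1156 * (real n * real s * ln (real n)))" using arith(4) by simp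
    finally show "?E (\<lambda>z. sqrt (4 * exp 1 * real k * M z)) \<le> sqrt (1156 * (real n * real s * ln (real n)))" .
    obtain X where "X \<in> smoothed_class n m r p" using F by auto
    moreover have "0 \<le> (\<Sum>i<n. \<Sum>j<m. pmf p (i, j) * \<bar>X $$ (i, j)\<bar>)" by (intro sum_nonneg) auto
    ultimately have "0 \<le> sqrt r" using smoothed_class_mean_abs_le[of X n m r p] n0 m(1) by linarith
    thus "0 \<le> 4 * (l * sqrt r)" using l by simp
  qed
  also have "sqrt (1156 * (real n * real s * ln (real n))) = 34 * sqrt (real n * real s * ln (real n))"
    using real_sqrt_mult[of "34\<^sup>2" "real n * real s * ln (real n)"] by simp
  finally show ?thesis by (simp add: mult_ac)
qed

section \<open>From uniform deviations to the minimizer\<close>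

lemma expected_loss_diff_le:
  fixes p :: "(nat \<times> nat) pmf"
  assumes ell: "lipschitz_loss l ell" and l: "0 \<le> l" and nm: "0 < n" "0 < m"
    and X: "X \<in> smoothed_class n m r p" and Z: "Z \<in> smoothed_class n m r p"
  shows "expected_loss n m ell Y p Z - expected_loss n m ell Y p X \<le> 4 * (l * sqrt r)"
proof -
  have "expected_loss n m ell Y p Z - expected_loss n m ell Y p X
      = (\<Sum>i<n. \<Sum>j<m. pmf p (i, j) * (ell (Z $$ (i, j)) (Y $$ (i, j)) - ell (X $$ (i, j)) (Y $$ (i, j))))"
    by (simp add: expected_loss_def sum_subtractf right_diff_distrib)
  also have "\<dots> \<le> (\<Sum>i<n. \<Sum>j<m. pmf p (i, j) * (l * (\<bar>Z $$ (i, j)\<bar> + \<bar>X $$ (i, j)\<bar>)))"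
  proof (intro sum_mono mult_left_mono)
    fix i j
    have "ell (Z $$ (i, j)) (Y $$ (i, j)) - ell (X $$ (i, j)) (Y $$ (i, j)) \<le> l * \<bar>Z $$ (i, j) - X $$ (i, j)\<bar>"
      using ell unfolding lipschitz_loss_def by (meson abs_le_D1)
    also have "\<dots> \<le> l * (\<bar>Z $$ (i, j)\<bar> + \<bar>X $$ (i, j)\<bar>)"
      using l by (intro mult_left_mono abs_triangle_ineq4)
    finally show "ell (Z $$ (i, j)) (Y $$ (i, j)) - ell (X $$ (i, j)) (Y $$ (i, j)) \<le> l * (\<bar>Z $$ (i, j)\<bar> + \<bar>X $$ (i, j)\<bar>)" .
  qed simp
  also have "\<dots> = l * ((\<Sum>i<n. \<Sum>j<m. pmf p (i, j) * \<bar>Z $$ (i, j)\<bar>) + (\<Sum>i<n. \<Sum>j<m. pmf p (i, j) * \<bar>X $$ (i, j)\<bar>))"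
    by (simp add: distrib_left sum.distrib sum_distrib_left mult_ac)
  also have "\<dots> \<le> l * (2 * sqrt r + 2 * sqrt r)"
    using l nm X Z by (intro mult_left_mono add_mono smoothed_class_mean_abs_le)
  finally show ?thesis by simp
qed

text \<open>The comparison is with one fixed competitor \<open>X\<close>, so that the infimum, which
  need not be attained, enters only at the very end.\<close>

lemma expected_loss_minimizer_le:
  fixes p :: "(nat \<times> nat) pmf"
  assumes m: "1 \<le> m" "m \<le> n" and s: "1 \<le> s" and r: "0 < r"
    and p: "set_pmf p \<subseteq> {..<n} \<times> {..<m}" and ell: "lipschitz_loss l ell"
    and Xhat: "\<And>S. S \<in> set_pmf (replicate_pmf s p) \<Longrightarrow>
      is_arg_min (empirical_loss ell Y S) (\<lambda>X. X \<in> smoothed_class n m r p) (Xhat S)"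
    and X: "X \<in> smoothed_class n m r p"
  shows "measure_pmf.expectation (replicate_pmf s p) (\<lambda>S. expected_loss n m ell Y p (Xhat S))
    \<le> expected_loss n m ell Y p X + 136 * l * sqrt (r * real n * ln (real n) / real s)"
proof -
  let ?A = "set_pmf p" and ?E = "product_mean s (set_pmf p) (pmf p)"
  let ?L = "expected_loss n m ell Y p"
  define Z where "Z z = Xhat (map z [0..<s])" for z
  have A: "finite ?A" using p by (rule finite_subset) auto
  have A1: "sum (pmf p) ?A = 1" using A by (simp add: sum_pmf_eq_1)
  have w: "0 \<le> pmf p a" for a by simp
  have l: "0 \<le> l"
  proof -
    have "\<bar>ell 1 0 - ell 0 0\<bar> \<le> l * \<bar>1 - 0\<bar>" using ell unfolding lipschitz_loss_def by blast
    thus ?thesis by simp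
  qed
  have nm: "0 < n" "0 < m" "0 < s" using m s by auto
  have support: "map z [0..<s] \<in> set_pmf (replicate_pmf s p)" if "z \<in> {..<s} \<rightarrow>\<^sub>E ?A" for z
    using that by (auto simp: set_replicate_pmf PiE_iff in_lists_conv_set)
  have Z_mem: "Z z \<in> smoothed_class n m r p" if "z \<in> {..<s} \<rightarrow>\<^sub>E ?A" for z
    using Xhat[OF support[OF that]] by (simp add: is_arg_min_def Z_def)
  have Z_min: "(\<Sum>t<s. ell (Z z $$ z t) (Y $$ z t)) \<le> (\<Sum>t<s. ell (X $$ z t) (Y $$ z t))"
    if "z \<in> {..<s} \<rightarrow>\<^sub>E ?A" for z
  proof -
    have "empirical_loss ell Y (map z [0..<s]) (Z z) \<le> empirical_loss ell Y (map z [0..<s]) X"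
      using Xhat[OF support[OF that]] X by (auto simp: is_arg_min_def Z_def not_less)
    thus ?thesis using nm by (simp add: empirical_loss_map divide_le_cancel)
  qed
  have "measure_pmf.expectation (replicate_pmf s p) (\<lambda>S. ?L (Xhat S)) = ?E (\<lambda>z. ?L (Z z))"
    unfolding Z_def by (rule expectation_replicate_pmf[OF A]) simp
  also have "\<dots> \<le> ?L X + 136 * l * sqrt (r * real n * ln (real n) / real s)"
  proof (cases "real n * ln (real n) \<le> real s")
    case False
    have "?E (\<lambda>z. ?L (Z z)) \<le> ?E (\<lambda>_. ?L X + 4 * (l * sqrt r))"
    proof (intro product_mean_mono w)
      fix z assume z: "z \<in> {..<s} \<rightarrow>\<^sub>E ?A"
      show "?L (Z z) \<le> ?L X + 4 * (l * sqrt r)"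
        using expected_loss_diff_le[OF ell l nm(1,2) X Z_mem[OF z], of Y] by linarith
    qed
    also have "\<dots> = ?L X + 4 * (l * sqrt r)" using A A1 by simp
    \<comment> \<open>Few samples: \<open>n ln n > s\<close> makes the rate at least
      \<open>136 * l * sqrt r\<close>, which exceeds the trivial difference
      \<open>4 * l * sqrt r\<close>.\<close>
    also have "l * sqrt r \<le> l * sqrt (r * real n * ln (real n) / real s)"
    proof (intro mult_left_mono l real_sqrt_le_mono)
      have "r * 1 \<le> r * (real n * ln (real n) / real s)"
        using False nm r by (intro mult_left_mono) (auto simp: pos_le_divide_eq)
      thus "r \<le> r * real n * ln (real n) / real s" by (simp add: mult.assoc)
    qed
    hence "?L X + 4 * (l * sqrt r) \<le> ?L X + 136 * l * sqrt (r * real n * ln (real n) / real s)"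
      using mult_nonneg_nonneg[OF l, of "sqrt r"] r by simp
    finally show ?thesis .
  next
    case True
    show ?thesis
    proof (cases "n = 1")
      \<comment> \<open>Since \<open>ln 1 = 0\<close> the rate vanishes, so nothing may be lost;
        there is only one cell to sample.\<close>
      case n1: True
      hence "m = 1" using m by simp
      hence A_sub: "?A \<subseteq> {(0, 0)}" using p n1 by auto
      hence A_eq: "?A = {(0, 0)}" using set_pmf_not_empty[of p] by auto
      have L: "?L V = ell (V $$ (0, 0)) (Y $$ (0, 0))" for V
        using A1 by (simp add: expected_loss_eq_sum[OF p] A_eq)
      have "?E (\<lambda>z. ?L (Z z)) \<le> ?E (\<lambda>_. ?L X)"
      proof (intro product_mean_mono w)
        fix z assume z: "z \<in> {..<s} \<rightarrow>\<^sub>E ?A"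
        hence "z t = (0, 0)" if "t < s" for t using A_eq that by (auto simp: PiE_iff)
        hence "real s * ?L (Z z) \<le> real s * ?L X" using Z_min[OF z] by (simp add: L)
        thus "?L (Z z) \<le> ?L X" using nm by simp
      qed
      also have "\<dots> = ?L X" using A A1 by simp
      finally show ?thesis using n1 by simp
    next
      case False
      hence n: "2 \<le> n" using nm by simp
      \<comment> \<open>The minimizer depends on the sample, so the deviation must be uniform, but
        only over the finitely many matrices it can return.\<close>
      define F where "F = Z ` ({..<s} \<rightarrow>\<^sub>E ?A)"
      have F: "finite F" "F \<noteq> {}" "F \<subseteq> smoothed_class n m r p"
        using A Z_mem by (auto simp: F_def finite_PiE PiE_eq_empty_iff set_pmf_not_empty)
      define G where "G z = (MAX V\<in>F. \<Sum>t<s. ?L V - ell (V $$ z t) (Y $$ z t))" for z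
      \<comment> \<open>The loss of \<open>Z z\<close> is its deviation, at most
        \<open>G z / s\<close>, plus its empirical loss, at most that of \<open>X\<close>. As
        \<open>X\<close> is fixed, the mean of its empirical loss is exactly
        \<open>?L X\<close>.\<close>
      have "?E (\<lambda>z. ?L (Z z)) \<le> ?E (\<lambda>z. 1 / real s * (G z + (\<Sum>t<s. ell (X $$ z t) (Y $$ z t))))"
      proof (intro product_mean_mono w)
        fix z assume z: "z \<in> {..<s} \<rightarrow>\<^sub>E ?A"
        have "(\<Sum>t<s. ?L (Z z) - ell (Z z $$ z t) (Y $$ z t)) \<le> G z"
          unfolding G_def using F z by (intro Max_ge) (auto simp: F_def)
        hence "real s * ?L (Z z) \<le> G z + (\<Sum>t<s. ell (X $$ z t) (Y $$ z t))"
          using Z_min[OF z] by (simp add: sum_subtractf)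
        thus "?L (Z z) \<le> 1 / real s * (G z + (\<Sum>t<s. ell (X $$ z t) (Y $$ z t)))"
          using nm by (simp add: field_simps)
      qed
      also have "\<dots> = 1 / real s * (?E G + real s * ?L X)"
        unfolding product_mean_cmult product_mean_add product_mean_sum expected_loss_eq_sum[OF p]
        using product_mean_coordinate[OF A A1, of _ s "\<lambda>a. ell (X $$ a) (Y $$ a)"] by simp
      also have "\<dots> \<le> 1 / real s * (136 * (l * sqrt r * sqrt (real n * real s * ln (real n))) + real s * ?L X)"
        unfolding G_def using generalization_gap[OF nm(2) m(2) n nm(3) True p ell l F]
        by (intro mult_left_mono add_right_mono) auto
      also have "\<dots> = ?L X + 136 * l * (sqrt r * sqrt (real n * real s * ln (real n)) / real s)"
        using nm by (simp add: field_simps)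
      also have "sqrt r * sqrt (real n * real s * ln (real n)) / real s = sqrt (r * real n * ln (real n) / real s)"
      proof -
        have "r * real n * ln (real n) / real s = r * (real n * real s * ln (real n)) / (real s)\<^sup>2"
          using nm by (simp add: power2_eq_square)
        thus ?thesis by (simp add: real_sqrt_divide real_sqrt_mult)
      qed
      finally show ?thesis .
    qed
  qed
  finally show ?thesis .
qed

theorem theorem3:
  shows "\<exists>K::real. \<forall>(n::nat) (m::nat) (Y::real mat) (s::nat) (r::real) (p::(nat \<times> nat) pmf)
      (l::real) (ell::real \<Rightarrow> real \<Rightarrow> real) (Xhat::(nat \<times> nat) list \<Rightarrow> real mat).
    1 \<le> m \<longrightarrow> m \<le> n \<longrightarrow> Y \<in> carrier_mat n m \<longrightarrow> 1 \<le> s \<longrightarrow> 0 < r \<longrightarrow>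
    set_pmf p \<subseteq> {..<n} \<times> {..<m} \<longrightarrow> lipschitz_loss l ell \<longrightarrow>
    (\<forall>S \<in> set_pmf (replicate_pmf s p).
       is_arg_min (empirical_loss ell Y S) (\<lambda>X. X \<in> smoothed_class n m r p) (Xhat S)) \<longrightarrow>
    measure_pmf.expectation (replicate_pmf s p) (\<lambda>S. expected_loss n m ell Y p (Xhat S))
      \<le> (INF X \<in> smoothed_class n m r p. expected_loss n m ell Y p X)
        + K * l * sqrt (r * real n * ln (real n) / real s)"
proof (intro exI[of _ 136] allI impI)
  fix n m :: nat and Y :: "real mat" and s :: nat and r :: real and p :: "(nat \<times> nat) pmf"
    and l :: real and ell :: "real \<Rightarrow> real \<Rightarrow> real" and Xhat :: "(nat \<times> nat) list \<Rightarrow> real mat"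
  assume asm: "1 \<le> m" "m \<le> n" "1 \<le> s" "0 < r" "set_pmf p \<subseteq> {..<n} \<times> {..<m}" "lipschitz_loss l ell"
    and Xhat: "\<forall>S \<in> set_pmf (replicate_pmf s p).
       is_arg_min (empirical_loss ell Y S) (\<lambda>X. X \<in> smoothed_class n m r p) (Xhat S)"
  let ?lhs = "measure_pmf.expectation (replicate_pmf s p) (\<lambda>S. expected_loss n m ell Y p (Xhat S))"
  let ?rate = "136 * l * sqrt (r * real n * ln (real n) / real s)"
  \<comment> \<open>The greatest-lower-bound property of \<open>INF\<close> asks for a nonempty
    class; a minimizer for any single sample is a member.\<close>
  obtain S where "S \<in> set_pmf (replicate_pmf s p)" using set_pmf_not_empty[of "replicate_pmf s p"] by blast
  hence nonempty: "smoothed_class n m r p \<noteq> {}" using Xhat by (auto simp: is_arg_min_def)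
  have "?lhs - ?rate \<le> (INF X \<in> smoothed_class n m r p. expected_loss n m ell Y p X)"
  proof (rule cINF_greatest[OF nonempty])
    fix X assume "X \<in> smoothed_class n m r p"
    thus "?lhs - ?rate \<le> expected_loss n m ell Y p X"
      using expected_loss_minimizer_le[OF asm, of Y Xhat X] Xhat by simp
  qed
  thus "?lhs \<le> (INF X \<in> smoothed_class n m r p. expected_loss n m ell Y p X) + ?rate" by simp
qed

end
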